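(* Let $k\ge 2$ and $n\ge 1$ be integers, and let $A$ be an $n\times n$ matrix with entries in $\{0,1\}$ such that $A^k=A$. Then $f(A)\le\gamma(n)$, with equality if and only if $A$ is permutation similar to a matrix of the form $$\begin{pmatrix} O_r & X & Z\\ 0 & P & Y\\ 0 & 0 & O_s\end{pmatrix},$$ where $r,s\ge 0$, $O_m$ is the $m\times m$ zero matrix (vacuous if $m=0$), $X,Y,Z$ are $0$-$1$ matrices of the appropriate sizes, $P=C_{n_1}\oplus\cdots\oplus C_{n_t}$ with $n_i\mid k-1$ for $i=1,\ldots,t$ (so $P$ has order $n-r-s$), and one of the following holds: (a) $r=(n-1)/2$ when $n$ is odd and $r\in\{n/2,\,n/2-1\}$ when $n$ is even; all entries of $X$ and of $Z$ equal $1$; and each column of $Y$ has exactly one nonzero entry; (b) $s=(n-1)/2$ when $n$ is odd and $s\in\{n/2,\,n/2-1\}$ when $n$ is even; all entries of $Y$ and of $Z$ equal $1$; and each row of $X$ has exactly one nonzero entry.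
   Context: For a $0$-$1$ matrix $A$, $f(A)$ denotes the number of nonzero entries of $A$. For a positive integer $n$, $\gamma(n)=(n+1)^2/4$ if $n$ is odd and $\gamma(n)=(n^2+2n)/4$ if $n$ is even. $C_m$ denotes the $m\times m$ basic circulant matrix (adjacency matrix of the directed $m$-cycle): $C_m(i,i+1)=1$ for $1\le i\le m-1$, $C_m(m,1)=1$, all other entries $0$ (so $C_1=(1)$); $\oplus$ denotes direct sum. Two square matrices are permutation similar if $B=Q^TAQ$ for some permutation matrix $Q$. *)

theory Defs
  imports Complex_Main "Jordan_Normal_Form.Matrix"
begin

definition zero_one_mat :: "int mat \<Rightarrow> bool" where
  "zero_one_mat A \<longleftrightarrow> elements_mat A \<subseteq> {0, 1}"

definition all_ones_mat :: "int mat \<Rightarrow> bool" where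
  "all_ones_mat A \<longleftrightarrow> (\<forall>i < dim_row A. \<forall>j < dim_col A. A $$ (i, j) = 1)"

definition num_nonzero :: "int mat \<Rightarrow> nat" where
  "num_nonzero A = card {(i, j). i < dim_row A \<and> j < dim_col A \<and> A $$ (i, j) \<noteq> 0}"

definition gamma_bound :: "nat \<Rightarrow> real" where
  "gamma_bound n =
     (if odd n then (real n + 1)\<^sup>2 / 4 else ((real n)\<^sup>2 + 2 * real n) / 4)"

text \<open>Matrix indices start at 0, so the last row of the circulant has index \<open>m - 1\<close>.\<close>

definition circulant :: "nat \<Rightarrow> int mat" where
  "circulant m =
     mat m m (\<lambda>(i, j). if j = i + 1 \<or> (i + 1 = m \<and> j = 0) then 1 else 0)"

definition one_nonzero_per_row :: "int mat \<Rightarrow> bool" where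
  "one_nonzero_per_row A \<longleftrightarrow>
     (\<forall>i < dim_row A. \<exists>!j. j < dim_col A \<and> A $$ (i, j) \<noteq> 0)"

definition one_nonzero_per_col :: "int mat \<Rightarrow> bool" where
  "one_nonzero_per_col A \<longleftrightarrow>
     (\<forall>j < dim_col A. \<exists>!i. i < dim_row A \<and> A $$ (i, j) \<noteq> 0)"

definition permutation_matrix :: "int mat \<Rightarrow> bool" where
  "permutation_matrix Q \<longleftrightarrow>
     square_mat Q \<and> zero_one_mat Q \<and> one_nonzero_per_row Q \<and> one_nonzero_per_col Q"

definition permutation_similar :: "int mat \<Rightarrow> int mat \<Rightarrow> bool" where
  "permutation_similar A B \<longleftrightarrow> square_mat A \<and>
     (\<exists>Q \<in> carrier_mat (dim_row A) (dim_row A).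
        permutation_matrix Q \<and> B = transpose_mat Q * A * Q)"

text \<open>The block matrix with rows \<open>(0, X, Z)\<close>, \<open>(0, P, Y)\<close>, \<open>(0, 0, 0)\<close>, where the zero
  diagonal blocks have orders \<open>r\<close> and \<open>s\<close>.\<close>

definition block_form ::
  "nat \<Rightarrow> nat \<Rightarrow> int mat \<Rightarrow> int mat \<Rightarrow> int mat \<Rightarrow> int mat \<Rightarrow> int mat" where
  "block_form r s P X Y Z =
     four_block_mat
       (four_block_mat (0\<^sub>m r r) X (0\<^sub>m (dim_row P) r) P) (Z @\<^sub>r Y)
       (0\<^sub>m s (r + dim_col P)) (0\<^sub>m s s)"

text \<open>The common condition on the order \<open>q\<close> of the distinguished zero block.\<close>

definition extremal_size :: "nat \<Rightarrow> nat \<Rightarrow> bool" where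
  "extremal_size n q \<longleftrightarrow>
     (if odd n then q = (n - 1) div 2 else q \<in> {n div 2, n div 2 - 1})"

end

theory Submission
  imports Defs
begin

(*
  Let E = A^(k-1), a nonnegative integer idempotent with A E = E A = A. The indices with E_ii > 0
  form the core C. Idempotency forces E to be the identity on C, and since the support of E is a
  dense transitive relation on a finite set, every nonzero entry E_ij factors through C. Hence A
  restricted to C is the matrix of a map sigma with sigma^(k-1) = id (disjoint cycles of length
  dividing k-1), and every other index has a zero row or a zero column: this is the block form.

  For a source i and a sink j, the out-neighbours of i and the in-neighbours of j in C, matched by a
  power of sigma, meet at most once, as the meetings are counted by (A^k)_ij <= 1. So the degrees
  satisfy x_i + y_j <= p + 1 with p = card C. Writing a for the largest x_i, the number of ones is
  at most p + r a + s (p + 1 - a) + r s, which is linear in a and takes the values (s + 1)(r + p) at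
  a = 1 and (r + 1)(s + p) at a = p; both are products of two factors with sum n + 1.
*)

section \<open>Counting nonzero entries\<close>

lemma sum_lessThan_add:
  fixes f :: "nat \<Rightarrow> 'a::comm_monoid_add"
  shows "(\<Sum>i<a + b. f i) = (\<Sum>i<a. f i) + (\<Sum>i<b. f (a + i))"
  by (induction b) (simp_all add: add.assoc)

lemma card_less_eq_sum: "card {j. j < b \<and> Q j} = (\<Sum>j<(b::nat). if Q j then 1 else 0)"
proof -
  have "{j. j < b \<and> Q j} = {j \<in> {..<b}. Q j}" by auto
  then show ?thesis by (simp only: card_eq_sum sum.inter_filter finite_lessThan)
qed

lemma num_nonzero_by_rows:
  assumes "A \<in> carrier_mat a b"
  shows "num_nonzero A = (\<Sum>i<a. card {j. j < b \<and> A $$ (i, j) \<noteq> 0})"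
proof -
  have "{(i, j). i < dim_row A \<and> j < dim_col A \<and> A $$ (i, j) \<noteq> 0}
      = Sigma {..<a} (\<lambda>i. {j. j < b \<and> A $$ (i, j) \<noteq> 0})"
    using assms by auto
  then show ?thesis unfolding num_nonzero_def by simp
qed

lemma num_nonzero_eq_sum:
  "num_nonzero A = (\<Sum>i<dim_row A. \<Sum>j<dim_col A. if A $$ (i, j) \<noteq> 0 then 1 else 0)"
  by (simp only: num_nonzero_by_rows[of A "dim_row A" "dim_col A"] carrier_matI card_less_eq_sum)

lemma num_nonzero_zero [simp]: "num_nonzero (0\<^sub>m a b) = 0"
  by (simp add: num_nonzero_eq_sum)

lemma num_nonzero_four_block_mat:
  assumes "A \<in> carrier_mat a c" "B \<in> carrier_mat a d" "C \<in> carrier_mat b c" "D \<in> carrier_mat b d"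
  shows "num_nonzero (four_block_mat A B C D) =
    num_nonzero A + num_nonzero B + num_nonzero C + num_nonzero D"
  using assms by (simp add: num_nonzero_eq_sum sum_lessThan_add sum.distrib)

lemma num_nonzero_by_cols:
  assumes "A \<in> carrier_mat a b"
  shows "num_nonzero A = (\<Sum>j<b. card {i. i < a \<and> A $$ (i, j) \<noteq> 0})"
proof -
  have "num_nonzero A = (\<Sum>j<b. \<Sum>i<a. if A $$ (i, j) \<noteq> 0 then 1 else 0)"
    using assms by (subst sum.swap) (simp add: num_nonzero_eq_sum)
  then show ?thesis by (simp only: card_less_eq_sum)
qed

text \<open>Bridges the \<open>\<exists>!\<close> in the definitions of one nonzero entry per row or
  column and the cardinalities used for counting.\<close>

lemma card_eq_one_iff_ex1: "card {x. P x} = 1 \<longleftrightarrow> (\<exists>!x. P x)"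
  by (auto simp: card_1_singleton_iff set_eq_iff)

lemma num_nonzero_one_per_row:
  "A \<in> carrier_mat a b \<Longrightarrow> one_nonzero_per_row A \<Longrightarrow> num_nonzero A = a"
  by (simp add: num_nonzero_by_rows one_nonzero_per_row_def flip: card_eq_one_iff_ex1)

lemma num_nonzero_one_per_col:
  "A \<in> carrier_mat a b \<Longrightarrow> one_nonzero_per_col A \<Longrightarrow> num_nonzero A = b"
  by (simp add: num_nonzero_by_cols one_nonzero_per_col_def flip: card_eq_one_iff_ex1)

lemma num_nonzero_all_ones:
  "A \<in> carrier_mat a b \<Longrightarrow> all_ones_mat A \<Longrightarrow> num_nonzero A = a * b"
  by (simp add: num_nonzero_eq_sum all_ones_mat_def)

lemma zero_one_matD:
  "zero_one_mat A \<Longrightarrow> i < dim_row A \<Longrightarrow> j < dim_col A \<Longrightarrow> A $$ (i, j) = 0 \<or> A $$ (i, j) = 1"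
  unfolding zero_one_mat_def using elements_matI[of A "dim_row A" "dim_col A" i j] by auto

lemma zero_one_matI:
  "(\<And>i j. i < dim_row A \<Longrightarrow> j < dim_col A \<Longrightarrow> A $$ (i, j) = 0 \<or> A $$ (i, j) = 1) \<Longrightarrow> zero_one_mat A"
  unfolding zero_one_mat_def using elements_matD by blast

section \<open>Circulant blocks and the block form\<close>

lemma circulant_carrier [simp]: "circulant m \<in> carrier_mat m m"
  by (simp add: circulant_def)

lemma dim_circulant [simp]: "dim_row (circulant m) = m" "dim_col (circulant m) = m"
  by (simp_all add: circulant_def)

lemma num_nonzero_circulant: "num_nonzero (circulant m) = m"
proof (rule num_nonzero_one_per_row[OF circulant_carrier], unfold one_nonzero_per_row_def, intro allI impI)
  fix i assume "i < dim_row (circulant m)"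
  then have i: "i < m" by (simp add: circulant_def)
  \<comment> \<open>The last row wraps around to column 0; for \<open>m = 1\<close> this is the
    diagonal entry.\<close>
  show "\<exists>!j. j < dim_col (circulant m) \<and> circulant m $$ (i, j) \<noteq> 0"
    using i by (intro ex1I[of _ "if i + 1 = m then 0 else i + 1"])
      (auto simp: circulant_def split: if_splits)
qed

lemma diag_circulant_carrier [simp]:
  "diag_block_mat (map circulant ns) \<in> carrier_mat (sum_list ns) (sum_list ns)"
proof -
  have "map dim_row (map circulant ns) = ns" "map dim_col (map circulant ns) = ns"
    by (induction ns) (simp_all add: circulant_def)
  then show ?thesis by (intro carrier_matI) (simp_all only: dim_diag_block_mat)
qed

lemma num_nonzero_diag_circulant: "num_nonzero (diag_block_mat (map circulant ns)) = sum_list ns"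
proof (induction ns)
  case (Cons m ns)
  let ?D = "diag_block_mat (map circulant ns)"
  have "?D \<in> carrier_mat (sum_list ns) (sum_list ns)" by simp
  then have "dim_row ?D = sum_list ns" "dim_col ?D = sum_list ns" by (blast dest: carrier_matD)+
  then show ?case
    using Cons num_nonzero_four_block_mat[OF circulant_carrier[of m] _ _ diag_circulant_carrier[of ns],
        of "0\<^sub>m m (sum_list ns)" "0\<^sub>m (sum_list ns) m"]
    by (simp add: Let_def num_nonzero_circulant)
qed simp

lemma block_form_carrier:
  assumes "P \<in> carrier_mat p p"
  shows "block_form r s P X Y Z \<in> carrier_mat (r + p + s) (r + p + s)"
  using assms by (auto simp: block_form_def)

lemma num_nonzero_block_form:
  assumes "P \<in> carrier_mat p p" "X \<in> carrier_mat r p" "Y \<in> carrier_mat p s" "Z \<in> carrier_mat r s"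
  shows "num_nonzero (block_form r s P X Y Z) =
    num_nonzero P + num_nonzero X + num_nonzero Y + num_nonzero Z"
proof -
  have "num_nonzero (four_block_mat (0\<^sub>m r r) X (0\<^sub>m p r) P) = num_nonzero X + num_nonzero P"
    using assms by (subst num_nonzero_four_block_mat[of _ r r _ p _ p]) auto
  \<comment> \<open>Stacking rows is a four-block matrix whose two right blocks have width
    0.\<close>
  moreover have "num_nonzero (Z @\<^sub>r Y) = num_nonzero Z + num_nonzero Y"
    unfolding append_rows_def
    using assms by (subst num_nonzero_four_block_mat[of _ r s _ 0 _ p]) auto
  ultimately show ?thesis
    unfolding block_form_def using assms
    by (subst num_nonzero_four_block_mat[of _ "r + p" "r + p" _ s _ s]) auto
qed

section \<open>Permutation similarity as relabelling of indices\<close>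

lemma index_mult_mat_sum:
  "A \<in> carrier_mat a b \<Longrightarrow> B \<in> carrier_mat b c \<Longrightarrow> i < a \<Longrightarrow> j < c \<Longrightarrow>
    (A * B) $$ (i, j) = (\<Sum>l<b. A $$ (i, l) * B $$ (l, j))"
  by (auto simp: scalar_prod_def lessThan_atLeast0 intro!: sum.cong)

text \<open>Column \<open>j\<close> of \<open>Q\<close> is the unit vector at
  \<open>\<pi> j\<close>, so \<open>Q\<close> on the right selects column \<open>\<pi> j\<close> and
  its transpose on the left selects row \<open>\<pi> i\<close>.\<close>

lemma conjugate_by_selection:
  fixes A Q :: "int mat"
  assumes A: "A \<in> carrier_mat n n" and Q: "Q \<in> carrier_mat n n"
    and Q_eq: "\<And>i j. i < n \<Longrightarrow> j < n \<Longrightarrow> Q $$ (i, j) = (if i = \<pi> j then 1 else 0)"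
    and \<pi>: "\<And>j. j < n \<Longrightarrow> \<pi> j < n"
  shows "transpose_mat Q * A * Q = mat n n (\<lambda>(i, j). A $$ (\<pi> i, \<pi> j))"
proof (rule eq_matI)
  fix a b assume "a < dim_row (mat n n (\<lambda>(i, j). A $$ (\<pi> i, \<pi> j)))"
    "b < dim_col (mat n n (\<lambda>(i, j). A $$ (\<pi> i, \<pi> j)))"
  then have a: "a < n" and b: "b < n" by auto
  have QA: "(transpose_mat Q * A) $$ (a, l) = A $$ (\<pi> a, l)" if l: "l < n" for l
  proof -
    have "(transpose_mat Q * A) $$ (a, l) = (\<Sum>i<n. (if i = \<pi> a then A $$ (i, l) else 0))"
      using A Q a l by (subst index_mult_mat_sum[of _ n n _ n]) (auto simp: Q_eq simp del: sum.delta sum.delta' intro!: sum.cong)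
    then show ?thesis using \<pi>[OF a] by simp
  qed
  have "(transpose_mat Q * A * Q) $$ (a, b) = (\<Sum>l<n. (if l = \<pi> b then A $$ (\<pi> a, l) else 0))"
    using A Q a b by (subst index_mult_mat_sum[of _ n n _ n]) (auto simp: Q_eq QA intro!: sum.cong simp del: index_mult_mat(1) sum.delta sum.delta')
  then show "(transpose_mat Q * A * Q) $$ (a, b) = mat n n (\<lambda>(i, j). A $$ (\<pi> i, \<pi> j)) $$ (a, b)"
    using \<pi>[OF b] a b by simp
qed (use A Q in auto)

lemma permutation_similarI:
  assumes A: "A \<in> carrier_mat n n" and \<pi>: "bij_betw \<pi> {..<n} {..<n}"
    and B: "B = mat n n (\<lambda>(i, j). A $$ (\<pi> i, \<pi> j))"
  shows "permutation_similar A B"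
proof -
  define Q :: "int mat" where "Q = mat n n (\<lambda>(i, j). if i = \<pi> j then 1 else 0)"
  have Q: "Q \<in> carrier_mat n n" by (simp add: Q_def)
  have less: "\<pi> j < n" if "j < n" for j using \<pi> that by (auto simp: bij_betw_def)
  have Q_eq: "Q $$ (i, j) = (if i = \<pi> j then 1 else 0)" if "i < n" "j < n" for i j
    using that by (simp add: Q_def)
  have row: "\<exists>!j. j < n \<and> Q $$ (i, j) \<noteq> 0" if "i < n" for i
  proof -
    have "\<exists>!j. j < n \<and> i = \<pi> j"
      using \<pi> that unfolding bij_betw_def inj_on_def by (metis (no_types, lifting) image_iff lessThan_iff)
    moreover have "j < n \<and> Q $$ (i, j) \<noteq> 0 \<longleftrightarrow> j < n \<and> i = \<pi> j" for j
      using that by (auto simp: Q_eq split: if_splits)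
    ultimately show ?thesis by simp
  qed
  have col: "\<exists>!i. i < n \<and> Q $$ (i, j) \<noteq> 0" if "j < n" for j
  proof (rule ex1I[of _ "\<pi> j"])
    show "i = \<pi> j" if "i < n \<and> Q $$ (i, j) \<noteq> 0" for i
      using that \<open>j < n\<close> by (cases "i = \<pi> j") (auto simp: Q_eq)
  qed (use that less Q_eq in simp)
  have "zero_one_mat Q"
    by (rule zero_one_matI) (simp add: Q_def)
  then have "permutation_matrix Q"
    unfolding permutation_matrix_def one_nonzero_per_row_def one_nonzero_per_col_def
    using row col Q by simp
  moreover have "B = transpose_mat Q * A * Q"
    unfolding B by (rule conjugate_by_selection[symmetric]) (use A Q less in \<open>auto simp: Q_def\<close>)
  ultimately show ?thesis
    using A Q by (auto simp: permutation_similar_def)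
qed

text \<open>Reads the relabelling off \<open>Q\<close>: \<open>\<pi> j\<close> is the row of the
  only nonzero entry in column \<open>j\<close>. Uniqueness within rows makes \<open>\<pi>\<close>
  injective, and finiteness makes it bijective.\<close>

lemma permutation_similarE:
  assumes "permutation_similar A B" and A: "A \<in> carrier_mat n n"
  obtains \<pi> where "bij_betw \<pi> {..<n} {..<n}" and "B = mat n n (\<lambda>(i, j). A $$ (\<pi> i, \<pi> j))"
proof -
  from assms obtain Q where Q: "Q \<in> carrier_mat n n" and perm: "permutation_matrix Q"
    and B: "B = transpose_mat Q * A * Q"
    by (auto simp: permutation_similar_def)
  from Q perm have col: "\<exists>!i. i < n \<and> Q $$ (i, j) \<noteq> 0" if "j < n" for j
    using that by (auto simp: permutation_matrix_def one_nonzero_per_col_def)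
  from Q perm have row: "\<exists>!j. j < n \<and> Q $$ (i, j) \<noteq> 0" if "i < n" for i
    using that by (auto simp: permutation_matrix_def one_nonzero_per_row_def)
  define \<pi> where "\<pi> j = (THE i. i < n \<and> Q $$ (i, j) \<noteq> 0)" for j
  have \<pi>: "\<pi> j < n \<and> Q $$ (\<pi> j, j) \<noteq> 0" if "j < n" for j
    unfolding \<pi>_def by (rule theI'[OF col[OF that]])
  have Q_eq: "Q $$ (i, j) = (if i = \<pi> j then 1 else 0)" if "i < n" "j < n" for i j
  proof -
    have "Q $$ (i, j) = 0 \<or> Q $$ (i, j) = 1"
      using perm Q that by (auto simp: permutation_matrix_def dest: zero_one_matD)
    then show ?thesis using \<pi>[OF that(2)] col[OF that(2)] that by auto
  qed
  have "inj_on \<pi> {..<n}"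
    by (intro inj_onI) (metis \<pi> row lessThan_iff)
  moreover have "\<pi> ` {..<n} \<subseteq> {..<n}" using \<pi> by auto
  ultimately have "bij_betw \<pi> {..<n} {..<n}"
    by (simp add: bij_betw_def endo_inj_surj)
  moreover have "B = mat n n (\<lambda>(i, j). A $$ (\<pi> i, \<pi> j))"
    unfolding B by (rule conjugate_by_selection) (use A Q Q_eq \<pi> in auto)
  ultimately show thesis by (rule that)
qed

lemma num_nonzero_permutation_similar:
  assumes "permutation_similar A B"
  shows "num_nonzero B = num_nonzero A"
proof -
  define n where "n = dim_row A"
  have A: "A \<in> carrier_mat n n" using assms by (auto simp: permutation_similar_def n_def)
  obtain \<pi> where \<pi>: "bij_betw \<pi> {..<n} {..<n}" and B: "B = mat n n (\<lambda>(i, j). A $$ (\<pi> i, \<pi> j))"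
    using permutation_similarE[OF assms A] by blast
  let ?f = "\<lambda>i j. if A $$ (i, j) \<noteq> 0 then 1 else (0::nat)"
  have "num_nonzero B = (\<Sum>i<n. \<Sum>j<n. ?f (\<pi> i) (\<pi> j))"
    by (simp add: num_nonzero_eq_sum B)
  also have "\<dots> = (\<Sum>i<n. \<Sum>j<n. ?f (\<pi> i) j)"
    by (intro sum.cong refl sum.reindex_bij_betw[OF \<pi>])
  also have "\<dots> = (\<Sum>i<n. \<Sum>j<n. ?f i j)"
    by (rule sum.reindex_bij_betw[OF \<pi>])
  also have "\<dots> = num_nonzero A" using A by (simp add: num_nonzero_eq_sum)
  finally show ?thesis .
qed

section \<open>Nonnegative matrices and the core\<close>

definition nonneg_mat :: "int mat \<Rightarrow> bool" where
  "nonneg_mat M \<longleftrightarrow> (\<forall>i < dim_row M. \<forall>j < dim_col M. 0 \<le> M $$ (i, j))"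

text \<open>Only nonnegative terms are dropped from the sum. The set \<open>L\<close> will be one
  index for positivity, two for uniqueness inside the core, and a set of core indices for the degree
  bound.\<close>

lemma nonneg_mat_mult_ge_sum:
  assumes "M \<in> carrier_mat n n" "N \<in> carrier_mat n n" "nonneg_mat M" "nonneg_mat N"
    and "i < n" "j < n" "L \<subseteq> {..<n}"
  shows "(\<Sum>l\<in>L. M $$ (i, l) * N $$ (l, j)) \<le> (M * N) $$ (i, j)"
  unfolding index_mult_mat_sum[OF assms(1,2,5,6)]
  using assms by (intro sum_mono2) (auto simp: nonneg_mat_def)

lemma nonneg_mat_mult_ge:
  assumes "M \<in> carrier_mat n n" "N \<in> carrier_mat n n" "nonneg_mat M" "nonneg_mat N"
    and "i < n" "j < n" "l < n"
  shows "M $$ (i, l) * N $$ (l, j) \<le> (M * N) $$ (i, j)"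
  using nonneg_mat_mult_ge_sum[OF assms(1-6), of "{l}"] assms(7) by simp

lemma nonneg_mat_mult_pos:
  assumes "M \<in> carrier_mat n n" "N \<in> carrier_mat n n" "nonneg_mat M" "nonneg_mat N"
    and "i < n" "j < n" "l < n" and "0 < M $$ (i, l)" "0 < N $$ (l, j)"
  shows "0 < (M * N) $$ (i, j)"
  using nonneg_mat_mult_ge[OF assms(1-7)] mult_pos_pos[OF assms(8,9)] by linarith

lemma nonneg_mat_mult_posE:
  assumes "M \<in> carrier_mat n n" "N \<in> carrier_mat n n" "nonneg_mat M" "nonneg_mat N"
    and "i < n" "j < n" and "0 < (M * N) $$ (i, j)"
  obtains l where "l < n" "0 < M $$ (i, l)" "0 < N $$ (l, j)"
proof -
  have "(\<Sum>l<n. M $$ (i, l) * N $$ (l, j)) \<noteq> 0"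
    using assms(7) by (simp only: index_mult_mat_sum[OF assms(1,2,5,6)])
  then obtain l where "l < n" "M $$ (i, l) * N $$ (l, j) \<noteq> 0"
    by (meson lessThan_iff sum.not_neutral_contains_not_neutral)
  moreover have "0 \<le> M $$ (i, l)" "0 \<le> N $$ (l, j)"
    using assms \<open>l < n\<close> by (auto simp: nonneg_mat_def)
  ultimately show thesis by (intro that) auto
qed

lemma nonneg_mat_mult:
  assumes "M \<in> carrier_mat n n" "N \<in> carrier_mat n n" "nonneg_mat M" "nonneg_mat N"
  shows "nonneg_mat (M * N)"
proof -
  have "0 \<le> (M * N) $$ (i, j)" if "i < n" "j < n" for i j
    using nonneg_mat_mult_ge_sum[OF assms that, of "{}"] by simp
  then show ?thesis using assms(1,2) by (simp add: nonneg_mat_def del: index_mult_mat(1))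
qed

lemma nonneg_mat_pow:
  assumes "M \<in> carrier_mat n n" "nonneg_mat M"
  shows "nonneg_mat (M ^\<^sub>m m)"
proof (induction m)
  case 0
  then show ?case using assms(1) by (simp add: nonneg_mat_def)
next
  case (Suc m)
  then show ?case using assms by (simp add: nonneg_mat_mult[of _ n])
qed

lemma pow_mat_add:
  assumes M: "M \<in> carrier_mat n n"
  shows "M ^\<^sub>m (a + b) = M ^\<^sub>m a * M ^\<^sub>m b"
proof (induction b)
  case 0
  then show ?case using M by (simp add: right_mult_one_mat[OF pow_carrier_mat[OF M]])
next
  case (Suc b)
  then show ?case
    using M assoc_mult_mat[OF pow_carrier_mat[OF M] pow_carrier_mat[OF M] M, of a b] by simp
qed

text \<open>Induction on the number of points between \<open>x\<close> and \<open>y\<close>. If the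
  intermediate point \<open>z\<close> is not related to itself, it lies between \<open>x\<close> and
  \<open>y\<close> but not between \<open>x\<close> and \<open>z\<close>, so the count drops when
  \<open>y\<close> is replaced by \<open>z\<close>.\<close>

lemma dense_transitive_reflexive_between:
  fixes r :: "'a \<Rightarrow> 'a \<Rightarrow> bool"
  assumes trans: "\<And>x y z. r x y \<Longrightarrow> r y z \<Longrightarrow> r x z"
    and dense: "\<And>x y. r x y \<Longrightarrow> \<exists>z. r x z \<and> r z y"
    and fin: "finite {z. r x z}"
    and "r x y"
  shows "\<exists>c. r c c \<and> r x c \<and> r c y"
  using \<open>r x y\<close>
proof (induction "card {z. r x z \<and> r z y}" arbitrary: y rule: less_induct)
  case less
  obtain z where z: "r x z" "r z y" using dense less.prems by blast
  show ?case
  proof (cases "r z z")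
    case True
    then show ?thesis using z by blast
  next
    case False
    have "{w. r x w \<and> r w z} \<subset> {w. r x w \<and> r w y}"
      using z False trans by blast
    moreover have "finite {w. r x w \<and> r w y}"
      using fin by (rule rev_finite_subset) auto
    ultimately have "\<exists>c. r c c \<and> r x c \<and> r c z"
      using less.hyps z(1) psubset_card_mono by blast
    then show ?thesis using z(2) trans by blast
  qed
qed

section \<open>The idempotent power and its core\<close>

locale potent_zero_one_mat =
  fixes n k :: nat and A :: "int mat"
  assumes k_ge_2: "2 \<le> k" and carrier: "A \<in> carrier_mat n n"
    and zero_one: "zero_one_mat A" and potent: "A ^\<^sub>m k = A"
begin

text \<open>An idempotent that fixes \<open>A\<close> from both sides, because
  \<open>A^k = A\<close>.\<close>

definition E :: "int mat" where "E = A ^\<^sub>m (k - 1)"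
text \<open>An inverse of \<open>A\<close> relative to \<open>E\<close>: both products of
  \<open>A\<close> and \<open>B\<close> are \<open>E\<close>. As \<open>k \<ge> 2\<close>, the
  exponent is not truncated; for \<open>k = 2\<close> the matrix \<open>B\<close> is the
  identity.\<close>

definition B :: "int mat" where "B = A ^\<^sub>m (k - 2)"

text \<open>Existence of a walk of length \<open>k - 1\<close> in the digraph of \<open>A\<close>,
  since the entries of \<open>E\<close> count these walks.\<close>

definition reach :: "nat \<Rightarrow> nat \<Rightarrow> bool" where
  "reach i j \<longleftrightarrow> i < n \<and> j < n \<and> 0 < E $$ (i, j)"

definition core :: "nat set" where "core = {i. reach i i}"

lemma dims [simp]: "dim_row A = n" "dim_col A = n"
  using carrier by auto

lemma entry: "i < n \<Longrightarrow> j < n \<Longrightarrow> A $$ (i, j) = 0 \<or> A $$ (i, j) = 1"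
  using zero_one_matD[OF zero_one] by simp

lemma nonneg_A: "nonneg_mat A"
  using entry unfolding nonneg_mat_def by force

lemma E_carrier: "E \<in> carrier_mat n n" and B_carrier: "B \<in> carrier_mat n n"
  using carrier by (simp_all add: E_def B_def)

lemma nonneg_E: "nonneg_mat E" and nonneg_B: "nonneg_mat B"
  by (simp_all add: E_def B_def nonneg_mat_pow[OF carrier nonneg_A])

lemma A_pow_1: "A ^\<^sub>m 1 = A"
  using carrier by simp

lemma AE: "A * E = A" and EA: "E * A = A" and AB: "A * B = E" and BA: "B * A = E"
proof -
  have "1 + (k - 1) = k" "k - 1 + 1 = k" "1 + (k - 2) = k - 1" "k - 2 + 1 = k - 1"
    using k_ge_2 by auto
  then show "A * E = A" "E * A = A" "A * B = E" "B * A = E"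
    unfolding E_def B_def using pow_mat_add[OF carrier] A_pow_1 potent by metis+
qed

lemma EE: "E * E = E"
  using AB AE assoc_mult_mat[OF E_carrier carrier B_carrier] EA by simp

lemma reach_trans: "reach i j \<Longrightarrow> reach j l \<Longrightarrow> reach i l"
  using nonneg_mat_mult_pos[OF E_carrier E_carrier nonneg_E nonneg_E, of i l j]
  by (simp add: reach_def EE)

text \<open>\<open>E * E = E\<close> makes \<open>reach\<close> transitive and also dense, since a
  positive entry of the product needs an intermediate index. Finiteness then supplies a reflexive
  point, which is a core index.\<close>

lemma reach_through_core:
  assumes "reach i j"
  obtains c where "c \<in> core" "reach i c" "reach c j"
proof -
  have "\<exists>c. reach c c \<and> reach i c \<and> reach c j"
  proof (rule dense_transitive_reflexive_between[of reach])
    show "reach i j" by (rule assms)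
  next
    fix x y assume "reach x y"
    then show "\<exists>z. reach x z \<and> reach z y"
      using nonneg_mat_mult_posE[OF E_carrier E_carrier nonneg_E nonneg_E, of x y]
      unfolding reach_def EE by metis
  next
    show "reach x z" if "reach x y" "reach y z" for x y z using that by (rule reach_trans)
  next
    show "finite {z. reach i z}"
      by (rule finite_subset[of _ "{..<n}"]) (auto simp: reach_def)
  qed
  then show thesis using that by (auto simp: core_def)
qed

lemma core_less: "c \<in> core \<Longrightarrow> c < n"
  by (simp add: core_def reach_def)

lemma finite_core: "finite core"
  by (rule finite_subset[of _ "{..<n}"]) (auto dest: core_less)

text \<open>For \<open>c \<noteq> d\<close> the terms \<open>l = c\<close> and \<open>l = d\<close>
  of \<open>E * E\<close> at \<open>(c, d)\<close> each contribute at least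
  \<open>E $$ (c, d) > 0\<close>, because the integer diagonal entries are at least 1. Their sum
  exceeds the entry of \<open>E * E = E\<close>.\<close>

lemma reach_core_unique:
  assumes "c \<in> core" "d \<in> core" "reach c d"
  shows "c = d"
proof (rule ccontr)
  assume "c \<noteq> d"
  have le: "c < n" "d < n" using assms core_less by auto
  then have "(\<Sum>l\<in>{c, d}. E $$ (c, l) * E $$ (l, d)) \<le> E $$ (c, d)"
    using nonneg_mat_mult_ge_sum[OF E_carrier E_carrier nonneg_E nonneg_E, of c d "{c, d}"]
    by (simp add: EE)
  then have *: "E $$ (c, c) * E $$ (c, d) + E $$ (c, d) * E $$ (d, d) \<le> E $$ (c, d)"
    using \<open>c \<noteq> d\<close> by simp
  have pos: "1 \<le> E $$ (c, c)" "1 \<le> E $$ (d, d)" "0 < E $$ (c, d)"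
    using assms by (simp_all add: core_def reach_def)
  have "1 * E $$ (c, d) \<le> E $$ (c, c) * E $$ (c, d)" "E $$ (c, d) * 1 \<le> E $$ (c, d) * E $$ (d, d)"
    using pos by (intro mult_right_mono mult_left_mono; simp)+
  with * pos show False by linarith
qed

text \<open>The chain from \<open>c\<close> to \<open>d\<close> forces \<open>c = d\<close>, so
  \<open>i\<close> reaches itself through \<open>c\<close>.\<close>

lemma reach_core_between:
  assumes "c \<in> core" "reach c i" "reach i d" "d \<in> core"
  shows "i \<in> core"
proof -
  have "c = d" using assms reach_trans reach_core_unique by blast
  then have "reach i i" using assms reach_trans by blast
  then show ?thesis by (simp add: core_def)
qed

text \<open>By \<open>E * A = A\<close>, the edge out of \<open>i\<close> yields an index reached
  from \<open>i\<close>, and \<open>reach\<close> factors through the core.\<close>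

lemma edge_out:
  assumes "i < n" "j < n" "A $$ (i, j) \<noteq> 0"
  obtains c where "c \<in> core" "reach i c"
proof -
  have "0 < (E * A) $$ (i, j)" using entry assms EA by force
  then obtain l where "l < n" "0 < E $$ (i, l)"
    using nonneg_mat_mult_posE[OF E_carrier carrier nonneg_E nonneg_A assms(1,2)] by blast
  then have "reach i l" using assms by (simp add: reach_def)
  then show thesis using reach_through_core that by blast
qed

text \<open>Dual of \<open>edge_out\<close>, from \<open>A * E = A\<close>.\<close>

lemma edge_in:
  assumes "i < n" "j < n" "A $$ (i, j) \<noteq> 0"
  obtains c where "c \<in> core" "reach c j"
proof -
  have "0 < (A * E) $$ (i, j)" using entry assms AE by force
  then obtain l where "l < n" "0 < E $$ (l, j)"
    using nonneg_mat_mult_posE[OF carrier E_carrier nonneg_A nonneg_E assms(1,2)] by blast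
  then have "reach l j" using assms by (simp add: reach_def)
  then show thesis using reach_through_core that by blast
qed

section \<open>The successor map on the core\<close>

lemma ex1_core_succ:
  assumes c: "c \<in> core"
  shows "\<exists>!d. d \<in> core \<and> A $$ (c, d) \<noteq> 0"
proof -
  have cn: "c < n" using c core_less by auto
  \<comment> \<open>The closed walk at \<open>c\<close> splits into an edge to \<open>d\<close> and
    a return walk counted by \<open>B\<close>.\<close>
  have "0 < (A * B) $$ (c, c)" using c by (simp add: AB core_def reach_def)
  then obtain d where d: "d < n" "0 < A $$ (c, d)" "0 < B $$ (d, c)"
    using nonneg_mat_mult_posE[OF carrier B_carrier nonneg_A nonneg_B cn cn] by blast
  \<comment> \<open>The return walk from \<open>d\<close> to \<open>c\<close> followed by any edge
    from \<open>c\<close> to \<open>e\<close> is counted by \<open>B * A = E\<close>. Taking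
    \<open>e = d\<close> puts \<open>d\<close> in the core; an \<open>e\<close> in the core must
    then equal \<open>d\<close>.\<close>
  have reach: "reach d e" if "e < n" "A $$ (c, e) \<noteq> 0" for e
    using nonneg_mat_mult_pos[OF B_carrier carrier nonneg_B nonneg_A, of d e c] d cn that
      entry[OF cn that(1)]
    by (auto simp: BA reach_def)
  have "d \<in> core" using reach[of d] d by (simp add: core_def)
  show ?thesis
  proof (rule ex1I[of _ d])
    show "d \<in> core \<and> A $$ (c, d) \<noteq> 0" using \<open>d \<in> core\<close> d by simp
    show "e = d" if "e \<in> core \<and> A $$ (c, e) \<noteq> 0" for e
      using that \<open>d \<in> core\<close> reach[of e] reach_core_unique[of d e] core_less[of e] by simp
  qed
qed

definition succ :: "nat \<Rightarrow> nat" where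
  "succ c = (THE d. d \<in> core \<and> A $$ (c, d) \<noteq> 0)"

lemma succ: "c \<in> core \<Longrightarrow> succ c \<in> core \<and> A $$ (c, succ c) \<noteq> 0"
  unfolding succ_def by (rule theI'[OF ex1_core_succ])

lemma edge_core_iff: "c \<in> core \<Longrightarrow> d \<in> core \<Longrightarrow> A $$ (c, d) = (if succ c = d then 1 else 0)"
  using succ[of c] ex1_core_succ[of c] entry[of c d] core_less by auto

lemma succ_pow: "c \<in> core \<Longrightarrow> (succ ^^ m) c \<in> core"
  by (induction m) (simp_all add: succ)

lemma pow_succ_pos: "c \<in> core \<Longrightarrow> 0 < (A ^\<^sub>m m) $$ (c, (succ ^^ m) c)"
proof (induction m)
  case 0
  then show ?case by (simp add: core_less)
next
  case (Suc m)
  let ?d = "(succ ^^ m) c"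
  have d: "?d \<in> core" using Suc.prems by (rule succ_pow)
  then have "0 < A $$ (?d, succ ?d)"
    using succ[OF d] edge_core_iff[OF d] by auto
  then show ?case
    using nonneg_mat_mult_pos[OF pow_carrier_mat[OF carrier] carrier nonneg_mat_pow[OF carrier nonneg_A] nonneg_A,
       of c "succ ?d" ?d m] Suc d succ[OF d] core_less by simp
qed

text \<open>Following \<open>succ\<close> for \<open>k - 1\<close> steps is a walk counted by
  \<open>E\<close>, and a core index reaches no core index but itself.\<close>

lemma succ_pow_period: 
  assumes "c \<in> core" shows "(succ ^^ (k - 1)) c = c"
proof -
  have "reach c ((succ ^^ (k - 1)) c)"
    using pow_succ_pos[OF assms, of "k - 1"] assms succ_pow core_less by (simp add: reach_def E_def)
  then show ?thesis using reach_core_unique assms succ_pow by metis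
qed

text \<open>The predecessor is \<open>succ\<close> applied \<open>k - 2\<close> times, one step
  before the return to \<open>c\<close>.\<close>

lemma core_pred:
  assumes "c \<in> core" obtains d where "d \<in> core" "succ d = c"
proof
  show "(succ ^^ (k - 2)) c \<in> core" using assms succ_pow by blast
  have "Suc (k - 2) = k - 1" using k_ge_2 by simp
  then show "succ ((succ ^^ (k - 2)) c) = c"
    using succ_pow_period[OF assms] by (metis funpow.simps(2) o_apply)
qed

text \<open>Extending the walk from \<open>i\<close> to a core index \<open>c\<close> by the edge to
  \<open>succ c\<close> gives a positive entry of \<open>E * A = A\<close>, so a single edge
  replaces the walk.\<close>

lemma edge_to_core:
  assumes "i < n" "j < n" "A $$ (i, j) \<noteq> 0"
  shows "\<exists>d\<in>core. A $$ (i, d) \<noteq> 0"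
proof -
  obtain c where c: "c \<in> core" "reach i c" using edge_out assms by blast
  have "0 < A $$ (c, succ c)" using c edge_core_iff succ by simp
  then have "0 < (E * A) $$ (i, succ c)"
    using nonneg_mat_mult_pos[OF E_carrier carrier nonneg_E nonneg_A, of i "succ c" c] c succ core_less
    by (auto simp: reach_def)
  then show ?thesis using c succ by (intro bexI[of _ "succ c"]) (simp_all add: EA)
qed

text \<open>Dual of \<open>edge_to_core\<close>: the walk starts at a core predecessor of
  \<open>c\<close>, and \<open>A * E = A\<close>.\<close>

lemma edge_from_core:
  assumes "i < n" "j < n" "A $$ (i, j) \<noteq> 0"
  shows "\<exists>d\<in>core. A $$ (d, j) \<noteq> 0"
proof -
  obtain c where c: "c \<in> core" "reach c j" using edge_in assms by blast
  obtain d where d: "d \<in> core" "succ d = c" using c core_pred by blast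
  have "0 < A $$ (d, c)" using c d edge_core_iff by simp
  then have "0 < (A * E) $$ (d, j)"
    using nonneg_mat_mult_pos[OF carrier E_carrier nonneg_A nonneg_E, of d j c] c d core_less
    by (auto simp: reach_def)
  then show ?thesis using d by (intro bexI[of _ d]) (simp_all add: AE)
qed

text \<open>The walks of length \<open>k\<close> from \<open>i\<close> into the core, \<open>k - 2\<close> steps along its cycles, and out to
  \<open>j\<close> number at most \<open>(A ^ k) i j \<le> 1\<close>; hence the out-neighbours of \<open>i\<close>, transported along the
  cycles, and the in-neighbours of \<open>j\<close> share at most one core vertex.\<close>

lemma core_degree_sum:
  assumes i: "i < n" and j: "j < n"
  shows "card {c \<in> core. A $$ (i, c) \<noteq> 0} + card {c \<in> core. A $$ (c, j) \<noteq> 0} \<le> card core + 1"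
proof -
  define \<tau> where "\<tau> = succ ^^ (k - 2)"
  define X where "X = {c \<in> core. A $$ (i, c) \<noteq> 0}"
  \<comment> \<open>The in-neighbours of \<open>j\<close> are indexed by their preimages under
    \<open>\<tau>\<close>, so that a \<open>c\<close> in both sets describes one walk
    \<open>i\<close>, \<open>c\<close>, ..., \<open>\<tau> c\<close>, \<open>j\<close> of length
    \<open>k\<close>.\<close>
  define Y where "Y = {c \<in> core. A $$ (\<tau> c, j) \<noteq> 0}"
  have k: "Suc (k - 2) = k - 1" using k_ge_2 by simp
  have left_inv: "succ (\<tau> c) = c" if "c \<in> core" for c
    using succ_pow_period[OF that] k unfolding \<tau>_def by (metis funpow.simps(2) o_apply)
  have \<tau>_core: "\<tau> c \<in> core" if "c \<in> core" for c using that succ_pow by (simp add: \<tau>_def)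
  have inj: "inj_on \<tau> core" using left_inv by (metis inj_onI)
  then have surj: "\<tau> ` core = core" using \<tau>_core by (intro endo_inj_surj finite_core) auto
  have "\<tau> ` Y = {c \<in> core. A $$ (c, j) \<noteq> 0}"
    using surj by (auto simp: Y_def \<tau>_core)
  then have card_Y: "card {c \<in> core. A $$ (c, j) \<noteq> 0} = card Y"
    using card_image[of \<tau> Y] inj by (metis (no_types, lifting) Y_def inj_on_subset mem_Collect_eq subsetI)
  have "of_nat (card (X \<inter> Y)) = (\<Sum>c\<in>X \<inter> Y. 1 :: int)" by simp
  also have "\<dots> \<le> (\<Sum>c\<in>X \<inter> Y. A $$ (i, c) * (B * A) $$ (c, j))"
  proof (rule sum_mono)
    fix c assume "c \<in> X \<inter> Y"
    then have c: "c \<in> core" "A $$ (i, c) \<noteq> 0" "A $$ (\<tau> c, j) \<noteq> 0" by (auto simp: X_def Y_def)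
    have less: "c < n" "\<tau> c < n" using c \<tau>_core core_less by auto
    have "0 < B $$ (c, \<tau> c)" using pow_succ_pos[OF c(1), of "k - 2"] by (simp add: B_def \<tau>_def)
    moreover have "0 < A $$ (\<tau> c, j)" using c entry[OF less(2) j] by auto
    ultimately have "0 < (B * A) $$ (c, j)"
      using nonneg_mat_mult_pos[OF B_carrier carrier nonneg_B nonneg_A less(1) j less(2)] by blast
    moreover have "A $$ (i, c) = 1" using c entry[OF i less(1)] by auto
    ultimately show "1 \<le> A $$ (i, c) * (B * A) $$ (c, j)" by simp
  qed
  also have "\<dots> \<le> (A * (B * A)) $$ (i, j)"
    by (rule nonneg_mat_mult_ge_sum[of _ n])
      (use carrier B_carrier nonneg_A nonneg_B i j core_less nonneg_mat_mult[of B n A] in \<open>auto simp: X_def\<close>)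
  also have "\<dots> = A $$ (i, j)" by (simp add: BA AE)
  also have "\<dots> \<le> 1" using entry[OF i j] by auto
  finally have "card (X \<inter> Y) \<le> 1" by simp
  moreover have "card (X \<union> Y) \<le> card core"
    by (rule card_mono[OF finite_core]) (auto simp: X_def Y_def)
  moreover have "card X + card Y = card (X \<union> Y) + card (X \<inter> Y)"
    using finite_core by (intro card_Un_Int) (simp_all add: X_def Y_def)
  ultimately have "card X + card Y \<le> card core + 1" by simp
  then show ?thesis unfolding card_Y X_def by simp
qed

section \<open>Sources and sinks\<close>

definition sinks :: "nat set" where
  "sinks = {i. i < n \<and> i \<notin> core \<and> (\<exists>c\<in>core. reach c i)}"

text \<open>Taken as the complement, so that the three classes partition the indices. An index with
  zero row and zero column counts as a source.\<close>

definition sources :: "nat set" where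
  "sources = {..<n} - core - sinks"

text \<open>By \<open>edge_in\<close>, an index with an incoming edge is reached from the core,
  hence is a core index or a sink.\<close>

lemma no_edge_into_source:
  assumes "i < n" "j \<in> sources"
  shows "A $$ (i, j) = 0"
proof (rule ccontr)
  have j: "j < n" "j \<notin> core" "j \<notin> sinks" using assms by (auto simp: sources_def)
  assume "A $$ (i, j) \<noteq> 0"
  then obtain c where "c \<in> core" "reach c j" using edge_in assms j by blast
  then show False using j by (auto simp: sinks_def)
qed

text \<open>An outgoing edge would place the sink between two core indices, hence in the
  core.\<close>

lemma no_edge_from_sink:
  assumes "i \<in> sinks" "j < n"
  shows "A $$ (i, j) = 0"
proof (rule ccontr)
  obtain c where c: "i < n" "i \<notin> core" "c \<in> core" "reach c i" using assms by (auto simp: sinks_def)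
  assume "A $$ (i, j) \<noteq> 0"
  then obtain d where "d \<in> core" "reach i d" using edge_out assms c by blast
  then show False using c reach_core_between by blast
qed

end

section \<open>Cycles and the block form\<close>

text \<open>The modulus sends the last entry back to the first, matching the wrap-around in
  \<open>circulant\<close>; a list of length one is a fixed point.\<close>

definition is_cycle :: "('a \<Rightarrow> 'a) \<Rightarrow> 'a list \<Rightarrow> bool" where
  "is_cycle f xs \<longleftrightarrow> (\<forall>i < length xs. f (xs ! i) = xs ! (Suc i mod length xs))"

text \<open>The orbit is listed up to the least positive return time \<open>l\<close>.\<close>

lemma periodic_point_cycle:
  fixes f :: "'a \<Rightarrow> 'a"
  assumes "0 < m" "(f ^^ m) c = c"
  obtains xs where "c \<in> set xs" "set xs \<subseteq> range (\<lambda>i. (f ^^ i) c)" "distinct xs"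
    "length xs dvd m" "is_cycle f xs"
proof -
  define l where "l = (LEAST l. 0 < l \<and> (f ^^ l) c = c)"
  have l: "0 < l \<and> (f ^^ l) c = c"
    unfolding l_def by (rule LeastI[of _ m]) (use assms in simp)
  have least: "l \<le> j" if "0 < j" "(f ^^ j) c = c" for j
    unfolding l_def by (rule Least_le) (use that in simp)
  define xs where "xs = map (\<lambda>i. (f ^^ i) c) [0..<l]"
  have len: "length xs = l" by (simp add: xs_def)
  \<comment> \<open>The remainder \<open>m mod l\<close> is also a return time but smaller than
    \<open>l\<close>, so it is 0.\<close>
  have "l dvd m"
    using least[of "m mod l"] l assms(2) funpow_mod_eq[of l f c m] mod_less_divisor[of l m]
    by (metis dvd_eq_mod_eq_0 linorder_not_le not_gr_zero)
  moreover have "distinct xs"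
  proof -
    have "(f ^^ i) c \<noteq> (f ^^ j) c" if "i < j" "j < l" for i j
    proof
      assume eq: "(f ^^ i) c = (f ^^ j) c"
      \<comment> \<open>Another \<open>l - j\<close> steps turn the repetition into a return at time
        \<open>l - j + i\<close>, which is positive and less than \<open>l\<close>.\<close>
      have "(f ^^ (l - j + i)) c = (f ^^ (l - j + j)) c" by (simp only: funpow_add o_apply eq)
      then have "(f ^^ (l - j + i)) c = c" using that l by simp
      then have "l \<le> l - j + i" by (intro least) (use that in auto)
      then show False using that by simp
    qed
    then have "inj_on (\<lambda>i. (f ^^ i) c) {0..<l}"
      by (intro linorder_inj_onI') auto
    then show ?thesis by (simp add: xs_def distinct_map)
  qed
  moreover have "is_cycle f xs"
    unfolding is_cycle_def len
  proof (intro allI impI)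
    fix i assume i: "i < l"
    then have "f (xs ! i) = (f ^^ Suc i) c" by (simp add: xs_def)
    also have "\<dots> = (f ^^ (Suc i mod l)) c" using l by (simp only: funpow_mod_eq)
    also have "\<dots> = xs ! (Suc i mod l)" using l by (simp add: xs_def)
    finally show "f (xs ! i) = xs ! (Suc i mod l)" .
  qed
  moreover have "c \<in> set xs" using l by (auto simp: xs_def intro: image_eqI[of _ _ 0])
  moreover have "set xs \<subseteq> range (\<lambda>i. (f ^^ i) c)" by (auto simp: xs_def)
  ultimately show thesis using that len by blast
qed

lemma is_cycle_closed: "is_cycle f xs \<Longrightarrow> x \<in> set xs \<Longrightarrow> f x \<in> set xs"
proof -
  assume cyc: "is_cycle f xs" and "x \<in> set xs"
  then obtain i where i: "i < length xs" "x = xs ! i" by (auto simp: in_set_conv_nth)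
  then have "f x = xs ! (Suc i mod length xs)" using cyc by (simp add: is_cycle_def)
  moreover have "Suc i mod length xs < length xs" using i by (intro mod_less_divisor) auto
  ultimately show "f x \<in> set xs" by simp
qed

text \<open>Orbits are split off one at a time; periodicity keeps the rest of the set
  invariant.\<close>

lemma cycle_decomposition:
  assumes "finite C" "0 < m" "\<And>c. c \<in> C \<Longrightarrow> f c \<in> C" "\<And>c. c \<in> C \<Longrightarrow> (f ^^ m) c = c"
  shows "\<exists>css. distinct (concat css) \<and> set (concat css) = C \<and>
    (\<forall>xs \<in> set css. length xs dvd m \<and> is_cycle f xs)"
  using assms(1,3,4)
proof (induction C rule: finite_psubset_induct)
  case (psubset C)
  show ?case
  proof (cases "C = {}")
    case True
    then show ?thesis by (intro exI[of _ "[]"]) simp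
  next
    case False
    then obtain c where c: "c \<in> C" by blast
    obtain xs where xs: "c \<in> set xs" "set xs \<subseteq> range (\<lambda>i. (f ^^ i) c)" "distinct xs"
      "length xs dvd m" "is_cycle f xs"
      using periodic_point_cycle[OF assms(2) psubset.prems(2)[OF c]] by blast
    have "(f ^^ i) c \<in> C" for i using c psubset.prems(1) by (induction i) auto
    then have sub: "set xs \<subseteq> C" using xs(2) by blast
    have closed: "(f ^^ i) d \<in> set xs" if "d \<in> set xs" for i d
      using that by (induction i) (auto intro: is_cycle_closed[OF xs(5)])
    have "f d \<in> C - set xs" if d: "d \<in> C - set xs" for d
    proof -
      \<comment> \<open>If \<open>f d\<close> lay on the cycle, \<open>m - 1\<close> further steps
        along it would end at \<open>d\<close>, which is off the cycle.\<close>
      have "f d \<notin> set xs"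
      proof
        assume "f d \<in> set xs"
        then have "(f ^^ (m - 1)) (f d) \<in> set xs" by (rule closed)
        moreover have "(f ^^ (m - 1)) (f d) = (f ^^ Suc (m - 1)) d"
          by (simp only: funpow_Suc_right o_apply)
        ultimately show False using d psubset.prems(2)[of d] assms(2) by simp
      qed
      then show ?thesis using d psubset.prems(1) by blast
    qed
    moreover have "C - set xs \<subset> C" using c xs(1) by blast
    ultimately obtain css where css: "distinct (concat css)" "set (concat css) = C - set xs"
      "\<forall>ys \<in> set css. length ys dvd m \<and> is_cycle f ys"
      using psubset.IH[of "C - set xs"] psubset.prems(2) by blast
    show ?thesis
    proof (intro exI[of _ "xs # css"] conjI)
      show "distinct (concat (xs # css))" using css xs(3) by auto
      show "set (concat (xs # css)) = C" using css sub by auto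
      show "\<forall>ys \<in> set (xs # css). length ys dvd m \<and> is_cycle f ys" using css xs by simp
    qed
  qed
qed

definition fun_mat :: "('a \<Rightarrow> 'a) \<Rightarrow> 'a list \<Rightarrow> int mat" where
  "fun_mat f xs = mat (length xs) (length xs) (\<lambda>(i, j). if f (xs ! i) = xs ! j then 1 else 0)"

lemma fun_mat_cycle:
  assumes "distinct xs" "is_cycle f xs"
  shows "fun_mat f xs = circulant (length xs)"
proof (rule eq_matI)
  let ?l = "length xs"
  fix i j assume "i < dim_row (circulant ?l)" "j < dim_col (circulant ?l)"
  then have i: "i < ?l" and j: "j < ?l" by auto
  have "f (xs ! i) = xs ! (Suc i mod ?l)" using assms(2) i by (simp add: is_cycle_def)
  moreover have "Suc i mod ?l < ?l" using i by (intro mod_less_divisor) auto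
  ultimately have "f (xs ! i) = xs ! j \<longleftrightarrow> Suc i mod ?l = j"
    using nth_eq_iff_index_eq[OF assms(1)] j by simp
  also have "\<dots> \<longleftrightarrow> j = i + 1 \<or> (i + 1 = ?l \<and> j = 0)"
    using i j by (cases "Suc i = ?l") auto
  finally show "fun_mat f xs $$ (i, j) = circulant ?l $$ (i, j)"
    using i j by (simp add: fun_mat_def circulant_def)
qed (simp_all add: fun_mat_def)

text \<open>Each cycle is closed under \<open>f\<close> and the cycles are disjoint, so all entries
  outside the diagonal blocks vanish; the diagonal blocks are circulants.\<close>

lemma fun_mat_cycles:
  assumes "distinct (concat css)" "\<forall>xs \<in> set css. is_cycle f xs"
  shows "fun_mat f (concat css) = diag_block_mat (map circulant (map length css))"
  using assms
proof (induction css)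
  case Nil
  then show ?case by (intro eq_matI) (simp_all add: fun_mat_def)
next
  case (Cons xs css)
  let ?ys = "concat css" and ?l = "length xs"
  have IH: "diag_block_mat (map circulant (map length css)) = fun_mat f ?ys"
    using Cons by simp
  have disj: "set xs \<inter> set ?ys = {}" using Cons.prems by simp
  have xs: "f x \<in> set xs" if "x \<in> set xs" for x
    using that Cons.prems is_cycle_closed[of f xs] by simp
  have ys: "f y \<in> set ?ys" if "y \<in> set ?ys" for y
    using that Cons.prems is_cycle_closed by fastforce
  have dim: "dim_row (fun_mat f zs) = length zs" "dim_col (fun_mat f zs) = length zs" for zs
    by (simp_all add: fun_mat_def)
  have "fun_mat f (xs @ ?ys) =
    four_block_mat (fun_mat f xs) (0\<^sub>m ?l (length ?ys)) (0\<^sub>m (length ?ys) ?l) (fun_mat f ?ys)"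
  proof (rule eq_matI; (unfold index_mat_four_block dim)?)
    fix i j assume i: "i < ?l + length ?ys" and j: "j < ?l + length ?ys"
    have off1: "f (xs ! i) \<noteq> ?ys ! (j - ?l)" if "i < ?l" "\<not> j < ?l"
    proof -
      have "f (xs ! i) \<in> set xs" using that xs by simp
      moreover have "?ys ! (j - ?l) \<in> set ?ys" using that j by (intro nth_mem) simp
      ultimately show ?thesis using disj by (metis disjoint_iff)
    qed
    have off2: "f (?ys ! (i - ?l)) \<noteq> xs ! j" if "\<not> i < ?l" "j < ?l"
    proof -
      have "f (?ys ! (i - ?l)) \<in> set ?ys" using that i by (intro ys nth_mem) simp
      moreover have "xs ! j \<in> set xs" using that by simp
      ultimately show ?thesis using disj by (metis disjoint_iff)
    qed
    show "fun_mat f (xs @ ?ys) $$ (i, j) =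
      four_block_mat (fun_mat f xs) (0\<^sub>m ?l (length ?ys)) (0\<^sub>m (length ?ys) ?l) (fun_mat f ?ys) $$ (i, j)"
      using i j off1 off2
      by (cases "i < ?l"; cases "j < ?l") (auto simp: dim, auto simp: fun_mat_def nth_append)
  qed simp_all
  then show ?case
    using IH fun_mat_cycle[of xs f] Cons.prems by (simp add: Let_def dim)
qed

text \<open>Rows of \<open>X\<close> and columns of \<open>Y\<close> are counted over list
  positions, the degree bound over core indices; this passes between the two.\<close>

lemma card_index_eq:
  "distinct xs \<Longrightarrow> card {i. i < length xs \<and> Q (xs ! i)} = card {x \<in> set xs. Q x}"
  by (metis distinct_card distinct_filter length_filter_conv_card set_filter)

section \<open>Assembling the block form\<close>

context potent_zero_one_mat
begin

text \<open>Listing the sources, then the core cycle by cycle, then the sinks gives the relabelling.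
  The last two clauses keep the degree bound and the core neighbours of each edge from a source to a
  sink, for use in the count.\<close>

lemma block_structure:
  obtains r s ns X Y Z where "\<forall>m \<in> set ns. m dvd k - 1" "r + sum_list ns + s = n"
    "X \<in> carrier_mat r (sum_list ns)" "zero_one_mat X"
    "Y \<in> carrier_mat (sum_list ns) s" "zero_one_mat Y"
    "Z \<in> carrier_mat r s" "zero_one_mat Z"
    "permutation_similar A (block_form r s (diag_block_mat (map circulant ns)) X Y Z)"
    "\<And>i j. i < r \<Longrightarrow> j < s \<Longrightarrow>
      card {c. c < sum_list ns \<and> X $$ (i, c) \<noteq> 0} + card {c. c < sum_list ns \<and> Y $$ (c, j) \<noteq> 0}
        \<le> sum_list ns + 1"
    "\<And>i j. i < r \<Longrightarrow> j < s \<Longrightarrow> Z $$ (i, j) \<noteq> 0 \<Longrightarrow>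
      (\<exists>c < sum_list ns. X $$ (i, c) \<noteq> 0) \<and> (\<exists>c < sum_list ns. Y $$ (c, j) \<noteq> 0)"
proof -
  obtain css where dist: "distinct (concat css)" and set_css: "set (concat css) = core"
    and css: "\<forall>xs \<in> set css. length xs dvd k - 1 \<and> is_cycle succ xs"
    using cycle_decomposition[OF finite_core, of "k - 1" succ] k_ge_2 succ succ_pow_period by auto
  define ns where "ns = map length css"
  define p where "p = sum_list ns"
  define us where "us = sorted_list_of_set sources"
  define cs where "cs = concat css"
  define vs where "vs = sorted_list_of_set sinks"
  define r where "r = length us"
  define s where "s = length vs"
  have len_cs: "length cs = p" by (simp add: p_def ns_def cs_def length_concat)
  have fin: "finite sources" "finite sinks" by (simp_all add: sources_def sinks_def)
  have us: "set us = sources" "distinct us" and vs: "set vs = sinks" "distinct vs"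
    using fin by (simp_all add: us_def vs_def)
  have cs: "set cs = core" "distinct cs" using dist set_css by (simp_all add: cs_def)
  define ws where "ws = us @ cs @ vs"
  have dist_ws: "distinct ws"
    unfolding ws_def using us vs cs by (auto simp: sources_def sinks_def)
  have set_ws: "set ws = {..<n}"
    unfolding ws_def using us vs cs core_less by (auto simp: sources_def sinks_def)
  have len_ws: "length ws = n"
    using distinct_card[OF dist_ws] set_ws by simp
  have rps: "r + p + s = n"
    using len_ws by (simp add: ws_def r_def s_def len_cs)
  have bij: "bij_betw ((!) ws) {..<n} {..<n}"
    by (rule bij_betw_nth[OF dist_ws]) (simp_all only: len_ws set_ws)
  define P where "P = diag_block_mat (map circulant ns)"
  have P_fun: "P = fun_mat succ cs"
    unfolding P_def ns_def cs_def using fun_mat_cycles[OF dist, of succ] css by simp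
  have P: "P \<in> carrier_mat p p" by (simp add: P_def p_def)
  define X where "X = mat r p (\<lambda>(i, c). A $$ (us ! i, cs ! c))"
  define Y where "Y = mat p s (\<lambda>(c, j). A $$ (cs ! c, vs ! j))"
  define Z where "Z = mat r s (\<lambda>(i, j). A $$ (us ! i, vs ! j))"
  have u: "us ! i \<in> sources" "us ! i < n" if "i < r" for i
    using that us nth_mem[of i us] by (auto simp: r_def sources_def)
  have v: "vs ! j \<in> sinks" "vs ! j < n" if "j < s" for j
    using that vs nth_mem[of j vs] by (auto simp: s_def sinks_def)
  have c: "cs ! i \<in> core" "cs ! i < n" if "i < p" for i
    using that cs nth_mem[of i cs] core_less by (auto simp: len_cs)
  have w: "ws ! i = (if i < r then us ! i else if i < r + p then cs ! (i - r) else vs ! (i - r - p))" for i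
    by (auto simp: ws_def nth_append r_def len_cs)
  have block: "block_form r s P X Y Z = mat n n (\<lambda>(i, j). A $$ (ws ! i, ws ! j))"
  proof (rule eq_matI)
    show "dim_row (block_form r s P X Y Z) = dim_row (mat n n (\<lambda>(i, j). A $$ (ws ! i, ws ! j)))"
      "dim_col (block_form r s P X Y Z) = dim_col (mat n n (\<lambda>(i, j). A $$ (ws ! i, ws ! j)))"
      using block_form_carrier[OF P, of r s X Y Z] rps by auto
    fix i j assume "i < dim_row (mat n n (\<lambda>(i, j). A $$ (ws ! i, ws ! j)))"
      "j < dim_col (mat n n (\<lambda>(i, j). A $$ (ws ! i, ws ! j)))"
    then have i: "i < r + p + s" and j: "j < r + p + s" by (simp_all add: rps)
    have dims: "dim_row P = p" "dim_col P = p" "dim_row X = r" "dim_col X = p"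
      "dim_row Y = p" "dim_col Y = s" "dim_row Z = r" "dim_col Z = s"
      using P by (auto simp: X_def Y_def Z_def)
    have blk: "block_form r s P X Y Z $$ (i, j) =
      (if i < r then if j < r then 0 else if j < r + p then X $$ (i, j - r) else Z $$ (i, j - r - p)
       else if i < r + p then
         if j < r then 0 else if j < r + p then P $$ (i - r, j - r) else Y $$ (i - r, j - r - p)
       else 0)"
      using i j by (auto simp: block_form_def append_rows_def dims)
    have src: "A $$ (ws ! i, ws ! j) = 0" if "j < r"
    proof -
      have "ws ! i < n" using i len_ws set_ws nth_mem[of i ws] by (auto simp: rps)
      then show ?thesis using no_edge_into_source u(1)[OF that] that by (simp add: w[of j])
    qed
    have snk: "A $$ (ws ! i, ws ! j) = 0" if "\<not> i < r + p"
    proof -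
      have "ws ! j < n" using j len_ws set_ws nth_mem[of j ws] by (auto simp: rps)
      moreover have "ws ! i \<in> sinks" using that i v(1)[of "i - r - p"] by (simp add: w[of i])
      ultimately show ?thesis using no_edge_from_sink by simp
    qed
    have "block_form r s P X Y Z $$ (i, j) = A $$ (ws ! i, ws ! j)"
    proof (cases "j < r \<or> \<not> i < r + p")
      case True
      then show ?thesis using src snk blk by auto
    next
      case False
      have PA: "P $$ (a, b) = A $$ (cs ! a, cs ! b)" if "a < p" "b < p" for a b
        using that edge_core_iff[OF c(1)[OF that(1)] c(1)[OF that(2)]]
        by (simp add: P_fun fun_mat_def len_cs)
      show ?thesis
        unfolding blk w using False i j by (auto simp: PA X_def Y_def Z_def)
    qed
    then show "block_form r s P X Y Z $$ (i, j) = mat n n (\<lambda>(i, j). A $$ (ws ! i, ws ! j)) $$ (i, j)"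
      using i j by (simp add: rps)
  qed
  have row_X: "card {c. c < p \<and> X $$ (i, c) \<noteq> 0} = card {c \<in> core. A $$ (us ! i, c) \<noteq> 0}"
    if "i < r" for i
  proof -
    have "{c. c < p \<and> X $$ (i, c) \<noteq> 0} = {c. c < length cs \<and> A $$ (us ! i, cs ! c) \<noteq> 0}"
      using that by (auto simp: X_def len_cs)
    then show ?thesis using card_index_eq[OF cs(2)] by (simp add: cs(1))
  qed
  have col_Y: "card {c. c < p \<and> Y $$ (c, j) \<noteq> 0} = card {c \<in> core. A $$ (c, vs ! j) \<noteq> 0}"
    if "j < s" for j
  proof -
    have "{c. c < p \<and> Y $$ (c, j) \<noteq> 0} = {c. c < length cs \<and> A $$ (cs ! c, vs ! j) \<noteq> 0}"
      using that by (auto simp: Y_def len_cs)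
    then show ?thesis using card_index_eq[OF cs(2)] by (simp add: cs(1))
  qed
  have card_core: "card core = p" using distinct_card[OF cs(2)] by (simp add: cs(1) len_cs)
  show thesis
  proof (rule that[of ns r s X Y Z], unfold p_def[symmetric] P_def[symmetric])
    show "\<forall>m \<in> set ns. m dvd k - 1" using css by (auto simp: ns_def)
    show "r + p + s = n" by (rule rps)
    show "X \<in> carrier_mat r p" "Y \<in> carrier_mat p s" "Z \<in> carrier_mat r s"
      by (simp_all add: X_def Y_def Z_def)
    show "zero_one_mat X" "zero_one_mat Y" "zero_one_mat Z"
      by (rule zero_one_matI; simp add: X_def Y_def Z_def entry u v c)+
    show "permutation_similar A (block_form r s P X Y Z)"
      by (rule permutation_similarI[OF carrier bij block])
  next
    fix i j assume i: "i < r" and j: "j < s"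
    show "card {c. c < p \<and> X $$ (i, c) \<noteq> 0} + card {c. c < p \<and> Y $$ (c, j) \<noteq> 0} \<le> p + 1"
      using core_degree_sum[OF u(2)[OF i] v(2)[OF j]] by (simp add: row_X[OF i] col_Y[OF j] card_core)
    assume "Z $$ (i, j) \<noteq> 0"
    then have edge: "A $$ (us ! i, vs ! j) \<noteq> 0" using i j by (simp add: Z_def)
    obtain d where d: "d \<in> core" "A $$ (us ! i, d) \<noteq> 0"
      using edge_to_core[OF u(2)[OF i] v(2)[OF j] edge] by blast
    obtain e where e: "e \<in> core" "A $$ (e, vs ! j) \<noteq> 0"
      using edge_from_core[OF u(2)[OF i] v(2)[OF j] edge] by blast
    obtain a b where "a < p" "cs ! a = d" "b < p" "cs ! b = e"
      using d e cs(1) len_cs by (metis in_set_conv_nth)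
    then show "(\<exists>c<p. X $$ (i, c) \<noteq> 0) \<and> (\<exists>c<p. Y $$ (c, j) \<noteq> 0)"
      using d e i j by (intro conjI exI[of _ a] exI[of _ b]) (simp_all add: X_def Y_def)
  qed
qed

end

section \<open>Extremal block forms\<close>

text \<open>The factors \<open>q + 1\<close> and \<open>n - q\<close> sum to \<open>n + 1\<close>,
  so the product is largest when they are balanced, and \<open>gamma_bound n\<close> is that
  balanced value.\<close>

lemma gamma_bound_product:
  assumes "1 \<le> n" "q \<le> n"
  shows "real ((q + 1) * (n - q)) \<le> gamma_bound n"
    and "real ((q + 1) * (n - q)) = gamma_bound n \<longleftrightarrow> extremal_size n q"
proof -
  have prod: "real ((q + 1) * (n - q)) = (real q + 1) * (real n - real q)"
    using assms(2) by (simp only: of_nat_mult of_nat_add of_nat_1 of_nat_diff)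
  have "real ((q + 1) * (n - q)) \<le> gamma_bound n \<and>
    (real ((q + 1) * (n - q)) = gamma_bound n \<longleftrightarrow> extremal_size n q)"
  proof (cases "odd n")
    case True
    then obtain m where m: "n = 2 * m + 1" by (elim oddE)
    have "real ((q + 1) * (n - q)) = gamma_bound n - (real q - real m)\<^sup>2"
      unfolding prod by (simp add: gamma_bound_def m power2_eq_square field_simps)
    moreover have "extremal_size n q \<longleftrightarrow> q = m"
      by (simp add: extremal_size_def m)
    ultimately show ?thesis by simp
  next
    case False
    then obtain m where m: "n = 2 * m" by (auto elim: evenE)
    \<comment> \<open>For even \<open>n\<close> the deficit is \<open>d * (d - 1)\<close>, which
      over the integers is nonnegative and zero exactly at 0 and 1. An integer is needed because
      \<open>q\<close> may exceed \<open>m\<close>.\<close>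
    define d where "d = int m - int q"
    have "0 \<le> d * (d - 1)" "d * (d - 1) = 0 \<longleftrightarrow> d = 0 \<or> d = 1"
      by (cases "d \<le> 0"; simp add: mult_nonpos_nonpos)+
    moreover have "real ((q + 1) * (n - q)) = gamma_bound n - real_of_int (d * (d - 1))"
      unfolding prod by (simp add: gamma_bound_def m d_def power2_eq_square field_simps)
    \<comment> \<open>As \<open>n \<ge> 1\<close> gives \<open>m \<ge> 1\<close>, the truncated
      \<open>m - 1\<close> is the case \<open>d = 1\<close>.\<close>
    moreover have "extremal_size n q \<longleftrightarrow> d = 0 \<or> d = 1"
      using assms by (auto simp: extremal_size_def m d_def)
    ultimately show ?thesis by (smt (verit) of_int_0_eq_iff of_int_nonneg)
  qed
  then show "real ((q + 1) * (n - q)) \<le> gamma_bound n"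
    and "real ((q + 1) * (n - q)) = gamma_bound n \<longleftrightarrow> extremal_size n q" by simp_all
qed

text \<open>A factor sum of at most \<open>n\<close> rather than \<open>n + 1\<close> gives at most
  \<open>n^2 / 4\<close>, below \<open>(n^2 + 2 n) / 4\<close>. This rules out equality in
  degenerate configurations.\<close>

lemma product_less_gamma_bound:
  assumes "1 \<le> n" "u + v \<le> n"
  shows "real (u * v) < gamma_bound n"
proof -
  have "0 \<le> (real u - real v)\<^sup>2" by simp
  then have "4 * (real u * real v) \<le> (real u + real v)\<^sup>2"
    by (simp add: power2_eq_square algebra_simps)
  also have "\<dots> \<le> (real n)\<^sup>2"
    using assms by (intro power_mono) (simp_all flip: of_nat_add)
  also have "\<dots> < (real n)\<^sup>2 + 2 * real n" using assms by simp
  also have "\<dots> \<le> 4 * gamma_bound n" by (simp add: gamma_bound_def power2_eq_square algebra_simps)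
  finally show ?thesis by simp
qed

section \<open>Row and column bounds with their equality cases\<close>

lemma num_nonzero_le_rows:
  assumes "M \<in> carrier_mat a b" "\<And>i. i < a \<Longrightarrow> card {j. j < b \<and> M $$ (i, j) \<noteq> 0} \<le> t"
  shows "num_nonzero M \<le> a * t"
    and "num_nonzero M = a * t \<Longrightarrow> i < a \<Longrightarrow> card {j. j < b \<and> M $$ (i, j) \<noteq> 0} = t"
proof -
  let ?f = "\<lambda>i. card {j. j < b \<and> M $$ (i, j) \<noteq> 0}"
  have eq: "num_nonzero M = (\<Sum>i<a. ?f i)" by (rule num_nonzero_by_rows[OF assms(1)])
  show "num_nonzero M \<le> a * t"
    unfolding eq using assms(2) sum_bounded_above[of "{..<a}" ?f t] by simp
  show "?f i = t" if "num_nonzero M = a * t" "i < a"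
    by (rule sum_mono_inv[of ?f "{..<a}" "\<lambda>_. t"]) (use that assms(2) eq in auto)
qed

lemma num_nonzero_le_cols:
  assumes "M \<in> carrier_mat a b" "\<And>j. j < b \<Longrightarrow> card {i. i < a \<and> M $$ (i, j) \<noteq> 0} \<le> t"
  shows "num_nonzero M \<le> b * t"
    and "num_nonzero M = b * t \<Longrightarrow> j < b \<Longrightarrow> card {i. i < a \<and> M $$ (i, j) \<noteq> 0} = t"
proof -
  let ?f = "\<lambda>j. card {i. i < a \<and> M $$ (i, j) \<noteq> 0}"
  have eq: "num_nonzero M = (\<Sum>j<b. ?f j)" by (rule num_nonzero_by_cols[OF assms(1)])
  show "num_nonzero M \<le> b * t"
    unfolding eq using assms(2) sum_bounded_above[of "{..<b}" ?f t] by simp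
  show "?f j = t" if "num_nonzero M = b * t" "j < b"
    by (rule sum_mono_inv[of ?f "{..<b}" "\<lambda>_. t"]) (use that assms(2) eq in auto)
qed

lemma card_less_Collect_le: "card {j. j < (b::nat) \<and> Q j} \<le> b"
  using card_mono[of "{..<b}" "{j. j < b \<and> Q j}"] by fastforce

lemma num_nonzero_le: "M \<in> carrier_mat a b \<Longrightarrow> num_nonzero M \<le> a * b"
  by (erule num_nonzero_le_rows(1)) (rule card_less_Collect_le)

lemma all_ones_matI:
  assumes M: "M \<in> carrier_mat a b" and "zero_one_mat M" "num_nonzero M = a * b"
  shows "all_ones_mat M"
  unfolding all_ones_mat_def
proof (intro allI impI)
  fix i j assume "i < dim_row M" "j < dim_col M"
  then have ij: "i < a" "j < b" using M by auto
  have "card {j. j < b \<and> M $$ (i, j) \<noteq> 0} = b"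
    by (rule num_nonzero_le_rows(2)[OF M card_less_Collect_le assms(3) ij(1)])
  then have "{j. j < b \<and> M $$ (i, j) \<noteq> 0} = {..<b}"
    by (intro card_subset_eq) auto
  then have "M $$ (i, j) \<noteq> 0" using ij by blast
  then show "M $$ (i, j) = 1" using zero_one_matD[OF assms(2), of i j] ij M by auto
qed

lemma one_nonzero_per_rowI:
  assumes "M \<in> carrier_mat a b" "\<And>i. i < a \<Longrightarrow> card {j. j < b \<and> M $$ (i, j) \<noteq> 0} = 1"
  shows "one_nonzero_per_row M"
  using assms by (simp add: one_nonzero_per_row_def flip: card_eq_one_iff_ex1)

lemma one_nonzero_per_colI:
  assumes "M \<in> carrier_mat a b" "\<And>j. j < b \<Longrightarrow> card {i. i < a \<and> M $$ (i, j) \<noteq> 0} = 1"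
  shows "one_nonzero_per_col M"
  using assms by (simp add: one_nonzero_per_col_def flip: card_eq_one_iff_ex1)

lemma card_pos_ex: "0 < card {c. c < p \<and> Q c} \<longleftrightarrow> (\<exists>c<(p::nat). Q c)"
  by (auto simp: card_gt_0_iff)

text \<open>\<open>deg\<close> limits \<open>X\<close> against \<open>Y\<close>, and
  \<open>supp\<close> makes \<open>Z\<close> vanish with either. An empty core, or a zero
  \<open>X\<close> or \<open>Y\<close> when core, sources and sinks are all nonempty, stays strictly
  below the bound. Without sources or without sinks the bound follows directly; the remaining case
  interpolates between the two products.\<close>

lemma block_count:
  fixes r s p n :: nat and X Y Z :: "int mat"
  assumes n: "1 \<le> n" "r + p + s = n"
    and X: "X \<in> carrier_mat r p" "zero_one_mat X"
    and Y: "Y \<in> carrier_mat p s" "zero_one_mat Y"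
    and Z: "Z \<in> carrier_mat r s" "zero_one_mat Z"
    and deg: "\<And>i j. i < r \<Longrightarrow> j < s \<Longrightarrow>
      card {c. c < p \<and> X $$ (i, c) \<noteq> 0} + card {c. c < p \<and> Y $$ (c, j) \<noteq> 0} \<le> p + 1"
    and supp: "\<And>i j. i < r \<Longrightarrow> j < s \<Longrightarrow> Z $$ (i, j) \<noteq> 0 \<Longrightarrow>
      (\<exists>c<p. X $$ (i, c) \<noteq> 0) \<and> (\<exists>c<p. Y $$ (c, j) \<noteq> 0)"
  defines "f \<equiv> p + num_nonzero X + num_nonzero Y + num_nonzero Z"
  shows "real f \<le> gamma_bound n \<and> (real f = gamma_bound n \<longrightarrow>
    extremal_size n r \<and> all_ones_mat X \<and> all_ones_mat Z \<and> one_nonzero_per_col Y \<or>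
    extremal_size n s \<and> all_ones_mat Y \<and> all_ones_mat Z \<and> one_nonzero_per_row X)"
    (is "_ \<and> (_ \<longrightarrow> ?a \<or> ?b)")
proof -
  define x where "x i = card {c. c < p \<and> X $$ (i, c) \<noteq> 0}" for i
  define y where "y j = card {c. c < p \<and> Y $$ (c, j) \<noteq> 0}" for j
  have X_le: "num_nonzero X \<le> r * p" and Y_le: "num_nonzero Y \<le> p * s" and Z_le: "num_nonzero Z \<le> r * s"
    using num_nonzero_le X Y Z by blast+
  have Z0: "num_nonzero Z = 0" if zero: "(\<forall>i<r. x i = 0) \<or> (\<forall>j<s. y j = 0)"
  proof -
    have "Z $$ (i, j) = 0" if ij: "i < r" "j < s" for i j
    proof (rule ccontr)
      assume "Z $$ (i, j) \<noteq> 0"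
      then have "0 < x i" "0 < y j" using supp[OF ij] unfolding x_def y_def card_pos_ex by blast+
      then show False using zero ij by auto
    qed
    moreover have "dim_row Z = r" "dim_col Z = s" using Z(1) by auto
    ultimately show ?thesis by (simp add: num_nonzero_eq_sum)
  qed
  have X0: "num_nonzero X = 0" if "\<forall>i<r. x i = 0"
    using that num_nonzero_le_rows(1)[OF X(1), folded x_def, of 0] by simp
  have Y0: "num_nonzero Y = 0" if "\<forall>j<s. y j = 0"
    using that num_nonzero_le_cols(1)[OF Y(1), folded y_def, of 0] by simp
  have size_s: "real ((s + 1) * (r + p)) \<le> gamma_bound n"
    "real ((s + 1) * (r + p)) = gamma_bound n \<longleftrightarrow> extremal_size n s"
  proof -
    have "n - s = r + p" using n(2) by simp
    then show "real ((s + 1) * (r + p)) \<le> gamma_bound n"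
      "real ((s + 1) * (r + p)) = gamma_bound n \<longleftrightarrow> extremal_size n s"
      using gamma_bound_product[OF n(1), of s] n(2) by simp_all
  qed
  have size_r: "real ((r + 1) * (p + s)) \<le> gamma_bound n"
    "real ((r + 1) * (p + s)) = gamma_bound n \<longleftrightarrow> extremal_size n r"
  proof -
    have "n - r = p + s" using n(2) by simp
    then show "real ((r + 1) * (p + s)) \<le> gamma_bound n"
      "real ((r + 1) * (p + s)) = gamma_bound n \<longleftrightarrow> extremal_size n r"
      using gamma_bound_product[OF n(1), of r] n(2) by simp_all
  qed
  \<comment> \<open>Closes the degenerate cases: the bound is strict, so the premise of the equality
    clause is false.\<close>
  have strict: ?thesis if "f \<le> u * v" "u + v \<le> n" for u v
  proof -
    have "real f \<le> real (u * v)" using that(1) by (simp only: of_nat_le_iff)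
    also have "\<dots> < gamma_bound n" using product_less_gamma_bound[OF n(1) that(2)] .
    finally show ?thesis by simp
  qed
  consider (p) "p = 0" | (r) "0 < p" "r = 0" | (s) "0 < p" "0 < r" "s = 0" | (pos) "0 < p" "0 < r" "0 < s"
    by fastforce
  then show ?thesis
  proof cases
    case p
    \<comment> \<open>With an empty core \<open>X\<close> and \<open>Y\<close> have no entries and
      \<open>supp\<close> removes \<open>Z\<close>, leaving \<open>f = 0\<close>.\<close>
    then have "\<forall>i<r. x i = 0" by (simp add: x_def)
    then show ?thesis using strict[of 0 0] p Z0 X_le Y_le by (simp add: f_def)
  next
    case r
    have f: "f = p + num_nonzero Y" using r X_le Z_le by (simp add: f_def)
    also have "\<dots> \<le> (s + 1) * (r + p)" using r Y_le by (simp add: mult.commute)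
    finally have le: "real f \<le> real ((s + 1) * (r + p))" by (simp only: of_nat_le_iff)
    moreover have ?b if "real f = gamma_bound n"
    proof -
      have "real f = real ((s + 1) * (r + p))" using that le size_s by linarith
      then have "f = (s + 1) * (r + p)" by (simp only: of_nat_eq_iff)
      then have "num_nonzero Y = p * s" using f r by (simp add: mult.commute)
      \<comment> \<open>With no sources the conditions on \<open>X\<close> and \<open>Z\<close> are
        vacuous.\<close>
      then show ?b
        using that le size_s all_ones_matI[OF Y] X(1) Z(1) r
        by (auto simp: all_ones_mat_def one_nonzero_per_row_def)
    qed
    ultimately show ?thesis using size_s by auto
  next
    case s
    have f: "f = p + num_nonzero X" using s Y_le Z_le by (simp add: f_def)
    also have "\<dots> \<le> (r + 1) * (p + s)" using s X_le by simp
    finally have le: "real f \<le> real ((r + 1) * (p + s))" by (simp only: of_nat_le_iff)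
    moreover have ?a if "real f = gamma_bound n"
    proof -
      have "real f = real ((r + 1) * (p + s))" using that le size_r by linarith
      then have "f = (r + 1) * (p + s)" by (simp only: of_nat_eq_iff)
      then have "num_nonzero X = r * p" using f s by simp
      \<comment> \<open>With no sinks the conditions on \<open>Y\<close> and \<open>Z\<close> are
        vacuous.\<close>
      then show ?a
        using that le size_r all_ones_matI[OF X] Y(1) Z(1) s
        by (auto simp: all_ones_mat_def one_nonzero_per_col_def)
    qed
    ultimately show ?thesis using size_r by auto
  next
    case pos
    define a where "a = Max (x ` {..<r})"
    define b where "b = Max (y ` {..<s})"
    have "a \<in> x ` {..<r}" unfolding a_def using pos by (intro Max_in) auto
    then obtain i0 where i0: "i0 < r" "a = x i0" by auto
    have "b \<in> y ` {..<s}" unfolding b_def using pos by (intro Max_in) auto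
    then obtain j0 where j0: "j0 < s" "b = y j0" by auto
    have x_le: "x i \<le> a" if "i < r" for i unfolding a_def using that by (intro Max_ge) auto
    have y_le: "y j \<le> b" if "j < s" for j unfolding b_def using that by (intro Max_ge) auto
    have ab: "a + b \<le> p + 1" using deg[OF i0(1) j0(1)] by (simp only: i0(2) j0(2) x_def y_def)
    have ap: "a \<le> p" unfolding i0(2) x_def by (rule card_less_Collect_le)
    note Xa = num_nonzero_le_rows[OF X(1), folded x_def, OF x_le]
    note Yb = num_nonzero_le_cols[OF Y(1), folded y_def, OF y_le]
    show ?thesis
    proof (cases "a = 0 \<or> b = 0")
      case True
      then show ?thesis
      proof
        assume "a = 0"
        then have "\<forall>i<r. x i = 0" using x_le by fastforce
        \<comment> \<open>Only \<open>p + p * s\<close> remains, and the factor sum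
          \<open>p + s + 1\<close> is at most \<open>n\<close> because
          \<open>r \<ge> 1\<close>.\<close>
        then have "f \<le> p * (s + 1)" using X0 Z0 Y_le by (simp add: f_def)
        then show ?thesis by (rule strict) (use pos n in simp)
      next
        assume "b = 0"
        then have "\<forall>j<s. y j = 0" using y_le by fastforce
        then have "f \<le> p * (r + 1)" using Y0 Z0 X_le by (simp add: f_def mult.commute)
        then show ?thesis by (rule strict) (use pos n in simp)
      qed
    next
      case False
      then have ab_pos: "1 \<le> a" "1 \<le> b" by auto
      \<comment> \<open>Writing \<open>p = a + c\<close> avoids truncated subtraction;
        \<open>c = 0\<close> will mean that \<open>X\<close> is full.\<close>
      define c where "c = p - a"
      have pac: "p = a + c" using ap by (simp add: c_def)
      have bc: "b \<le> c + 1" using ab pac by simp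
      define F where "F = p + r * a + s * (c + 1) + r * s"
      have sb: "s * b \<le> s * (c + 1)" using bc by (rule mult_le_mono2)
      have fF: "f \<le> F" using Xa(1) Yb(1) sb Z_le unfolding f_def F_def by linarith
      \<comment> \<open>\<open>F\<close> has slope \<open>r - s\<close> in \<open>a\<close>. These
        identities compare it with its values at \<open>a = 1\<close> and \<open>a = p\<close>; the
        sign of \<open>s - r\<close> decides which value dominates.\<close>
      have F_s: "int ((s + 1) * (r + p)) = int F + (int s - int r) * (int a - 1)"
        by (simp add: F_def pac algebra_simps)
      have F_r: "int ((r + 1) * (p + s)) = int F + (int r - int s) * int c"
        by (simp add: F_def pac algebra_simps)
      \<comment> \<open>\<open>F\<close> is a sum of separate bounds, so equality makes each of them
        tight; cancelling \<open>s > 0\<close> gives \<open>b = c + 1\<close>.\<close>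
      have tight: "num_nonzero X = r * a \<and> num_nonzero Y = s * b \<and> b = c + 1 \<and> num_nonzero Z = r * s"
        if "f = F"
      proof -
        have "num_nonzero X = r * a \<and> num_nonzero Y = s * b \<and> s * b = s * (c + 1) \<and> num_nonzero Z = r * s"
          using that Xa(1) Yb(1) sb Z_le unfolding f_def F_def by linarith
        then show ?thesis using pos(3) nat_mult_eq_cancel1[of s b "c + 1"] by blast
      qed
      \<comment> \<open>At \<open>a = 1\<close> every row of \<open>X\<close> has one entry, and
        \<open>b = c + 1 = p\<close> makes \<open>Y\<close> full.\<close>
      have form_b: ?b if "f = F" "extremal_size n s" "a = 1"
        using tight[OF that(1)] that pac Xa(2) all_ones_matI[OF Y] all_ones_matI[OF Z]
        by (auto intro!: one_nonzero_per_rowI[OF X(1), folded x_def] simp: mult.commute)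
      \<comment> \<open>At \<open>c = 0\<close> the roles are exchanged: \<open>a = p\<close> makes
        \<open>X\<close> full and \<open>b = 1\<close>.\<close>
      have form_a: ?a if "f = F" "extremal_size n r" "c = 0"
        using tight[OF that(1)] that pac Yb(2) all_ones_matI[OF X] all_ones_matI[OF Z]
        by (auto intro!: one_nonzero_per_colI[OF Y(1), folded y_def])
      \<comment> \<open>For \<open>r = s\<close> the value of \<open>F\<close> does not depend on
        \<open>a\<close>, so intermediate \<open>a\<close> must be excluded otherwise:
        \<open>n = 2 s + p\<close> and the extremal size leave \<open>p \<le> 2\<close>, hence
        \<open>a = 1\<close> or \<open>a = p\<close>.\<close>
      have p_le_2: "p \<le> 2" if "r = s" "extremal_size n s"
        using that n by (auto simp: extremal_size_def split: if_splits elim!: oddE evenE)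
      show ?thesis
      proof (cases "r \<le> s")
        case True
        have "0 \<le> (int s - int r) * (int a - 1)" using True ab_pos by simp
        then have "F \<le> (s + 1) * (r + p)" using F_s by linarith
        then have le: "real f \<le> real F" "real F \<le> real ((s + 1) * (r + p))"
          using fF by (simp_all only: of_nat_le_iff)
        have "?a \<or> ?b" if "real f = gamma_bound n"
        proof -
          have ext: "extremal_size n s" and eq: "real f = real F" "real F = real ((s + 1) * (r + p))"
            using le size_s that by linarith+
          from eq have "f = F" "F = (s + 1) * (r + p)" by (simp_all only: of_nat_eq_iff)
          then have "s = r \<or> a = 1" using F_s by auto
          moreover have "c = 0 \<or> a = 1" if "s = r" using p_le_2 that ext pac ab_pos by auto
          ultimately show ?thesis using form_a form_b \<open>f = F\<close> ext by blast
        qed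
        then show ?thesis using le size_s by linarith
      next
        case False
        then have "0 \<le> (int r - int s) * int c" by simp
        then have "F \<le> (r + 1) * (p + s)" using F_r by linarith
        then have le: "real f \<le> real F" "real F \<le> real ((r + 1) * (p + s))"
          using fF by (simp_all only: of_nat_le_iff)
        have ?a if "real f = gamma_bound n"
        proof -
          have ext: "extremal_size n r" and eq: "real f = real F" "real F = real ((r + 1) * (p + s))"
            using le size_r that by linarith+
          from eq have "f = F" "F = (r + 1) * (p + s)" by (simp_all only: of_nat_eq_iff)
          \<comment> \<open>Here \<open>r > s\<close> strictly, so the factor
            \<open>int r - int s\<close> cannot be the one that vanishes.\<close>
          then have "c = 0" using F_r False by auto
          then show ?thesis using form_a \<open>f = F\<close> ext by blast
        qed
        then show ?thesis using le size_r by linarith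
      qed
    qed
  qed
qed

section \<open>The extremal forms attain the bound\<close>

lemma num_nonzero_extremal_block_form:
  assumes n: "1 \<le> n" "r + sum_list ns + s = n"
    and X: "X \<in> carrier_mat r (sum_list ns)" and Y: "Y \<in> carrier_mat (sum_list ns) s"
    and Z: "Z \<in> carrier_mat r s"
    and ext: "extremal_size n r \<and> all_ones_mat X \<and> all_ones_mat Z \<and> one_nonzero_per_col Y \<or>
      extremal_size n s \<and> all_ones_mat Y \<and> all_ones_mat Z \<and> one_nonzero_per_row X"
  shows "real (num_nonzero (block_form r s (diag_block_mat (map circulant ns)) X Y Z)) = gamma_bound n"
proof -
  let ?p = "sum_list ns"
  have count: "num_nonzero (block_form r s (diag_block_mat (map circulant ns)) X Y Z) =
      ?p + num_nonzero X + num_nonzero Y + num_nonzero Z"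
    using num_nonzero_block_form[OF diag_circulant_carrier X Y Z] by (simp add: num_nonzero_diag_circulant)
  have nr: "n - r = ?p + s" "n - s = r + ?p" using n(2) by auto
  from ext show ?thesis
  proof
    assume *: "extremal_size n r \<and> all_ones_mat X \<and> all_ones_mat Z \<and> one_nonzero_per_col Y"
    \<comment> \<open>The count \<open>?p + r * ?p + s + r * s\<close> factors as
      \<open>(r + 1) * (?p + s)\<close>.\<close>
    then have "?p + num_nonzero X + num_nonzero Y + num_nonzero Z = (r + 1) * (n - r)"
      using num_nonzero_all_ones[OF X] num_nonzero_all_ones[OF Z] num_nonzero_one_per_col[OF Y]
      by (simp add: nr algebra_simps)
    then show ?thesis using * gamma_bound_product(2)[OF n(1), of r] n(2) by (simp only: count)
  next
    assume *: "extremal_size n s \<and> all_ones_mat Y \<and> all_ones_mat Z \<and> one_nonzero_per_row X"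
    then have "?p + num_nonzero X + num_nonzero Y + num_nonzero Z = (s + 1) * (n - s)"
      using num_nonzero_all_ones[OF Y] num_nonzero_all_ones[OF Z] num_nonzero_one_per_row[OF X]
      by (simp add: nr algebra_simps)
    then show ?thesis using * gamma_bound_product(2)[OF n(1), of s] n(2) by (simp only: count)
  qed
qed

theorem theorem3p3:
  fixes k n :: nat and A :: "int mat"
  assumes "k \<ge> 2" and "n \<ge> 1"
    and "A \<in> carrier_mat n n"
    and "zero_one_mat A"
    and "A ^\<^sub>m k = A"
  shows "real (num_nonzero A) \<le> gamma_bound n \<and>
    (real (num_nonzero A) = gamma_bound n \<longleftrightarrow>
      (\<exists>(r::nat) (s::nat) (ns::nat list) P X Y Z.
         P = diag_block_mat (map circulant ns) \<and>
         (\<forall>m \<in> set ns. m dvd k - 1) \<and>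
         r + sum_list ns + s = n \<and>
         X \<in> carrier_mat r (sum_list ns) \<and> zero_one_mat X \<and>
         Y \<in> carrier_mat (sum_list ns) s \<and> zero_one_mat Y \<and>
         Z \<in> carrier_mat r s \<and> zero_one_mat Z \<and>
         permutation_similar A (block_form r s P X Y Z) \<and>
         (extremal_size n r \<and> all_ones_mat X \<and> all_ones_mat Z \<and> one_nonzero_per_col Y \<or>
          extremal_size n s \<and> all_ones_mat Y \<and> all_ones_mat Z \<and> one_nonzero_per_row X)))"
proof (intro conjI iffI)
  let ?f = "real (num_nonzero A)"
  interpret potent_zero_one_mat n k A
    by unfold_locales (use assms in simp_all)
  obtain r s ns X Y Z where *: "\<forall>m \<in> set ns. m dvd k - 1" "r + sum_list ns + s = n"
    "X \<in> carrier_mat r (sum_list ns)" "zero_one_mat X"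
    "Y \<in> carrier_mat (sum_list ns) s" "zero_one_mat Y"
    "Z \<in> carrier_mat r s" "zero_one_mat Z"
    "permutation_similar A (block_form r s (diag_block_mat (map circulant ns)) X Y Z)"
    and deg: "\<And>i j. i < r \<Longrightarrow> j < s \<Longrightarrow>
      card {c. c < sum_list ns \<and> X $$ (i, c) \<noteq> 0} + card {c. c < sum_list ns \<and> Y $$ (c, j) \<noteq> 0}
        \<le> sum_list ns + 1"
    and supp: "\<And>i j. i < r \<Longrightarrow> j < s \<Longrightarrow> Z $$ (i, j) \<noteq> 0 \<Longrightarrow>
      (\<exists>c < sum_list ns. X $$ (i, c) \<noteq> 0) \<and> (\<exists>c < sum_list ns. Y $$ (c, j) \<noteq> 0)"
    by (rule block_structure) blast
  \<comment> \<open>The diagonal block contributes exactly its order, one entry per row of each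
    circulant.\<close>
  have f: "num_nonzero A = sum_list ns + num_nonzero X + num_nonzero Y + num_nonzero Z"
    using num_nonzero_permutation_similar[OF *(9)]
      num_nonzero_block_form[OF diag_circulant_carrier *(3,5,7)]
    by (simp only: num_nonzero_diag_circulant)
  have count: "?f \<le> gamma_bound n \<and> (?f = gamma_bound n \<longrightarrow>
      extremal_size n r \<and> all_ones_mat X \<and> all_ones_mat Z \<and> one_nonzero_per_col Y \<or>
      extremal_size n s \<and> all_ones_mat Y \<and> all_ones_mat Z \<and> one_nonzero_per_row X)"
    unfolding f
    by (rule block_count[OF assms(2) *(2-8)]; (erule (1) deg | erule (2) supp))
  show "?f \<le> gamma_bound n" using count by blast
  show "\<exists>(r::nat) (s::nat) (ns::nat list) P X Y Z.
         P = diag_block_mat (map circulant ns) \<and>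
         (\<forall>m \<in> set ns. m dvd k - 1) \<and>
         r + sum_list ns + s = n \<and>
         X \<in> carrier_mat r (sum_list ns) \<and> zero_one_mat X \<and>
         Y \<in> carrier_mat (sum_list ns) s \<and> zero_one_mat Y \<and>
         Z \<in> carrier_mat r s \<and> zero_one_mat Z \<and>
         permutation_similar A (block_form r s P X Y Z) \<and>
         (extremal_size n r \<and> all_ones_mat X \<and> all_ones_mat Z \<and> one_nonzero_per_col Y \<or>
          extremal_size n s \<and> all_ones_mat Y \<and> all_ones_mat Z \<and> one_nonzero_per_row X)"
    if "?f = gamma_bound n"
    by (rule exI[of _ r], rule exI[of _ s], rule exI[of _ ns],
        rule exI[of _ "diag_block_mat (map circulant ns)"],
        rule exI[of _ X], rule exI[of _ Y], rule exI[of _ Z])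
      (intro conjI * refl count[THEN conjunct2, THEN mp, OF that])
next
  assume "\<exists>(r::nat) (s::nat) (ns::nat list) P X Y Z.
         P = diag_block_mat (map circulant ns) \<and>
         (\<forall>m \<in> set ns. m dvd k - 1) \<and>
         r + sum_list ns + s = n \<and>
         X \<in> carrier_mat r (sum_list ns) \<and> zero_one_mat X \<and>
         Y \<in> carrier_mat (sum_list ns) s \<and> zero_one_mat Y \<and>
         Z \<in> carrier_mat r s \<and> zero_one_mat Z \<and>
         permutation_similar A (block_form r s P X Y Z) \<and>
         (extremal_size n r \<and> all_ones_mat X \<and> all_ones_mat Z \<and> one_nonzero_per_col Y \<or>
          extremal_size n s \<and> all_ones_mat Y \<and> all_ones_mat Z \<and> one_nonzero_per_row X)"
  then obtain r s ns X Y Z where "r + sum_list ns + s = n"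
    and XYZ: "X \<in> carrier_mat r (sum_list ns)" "Y \<in> carrier_mat (sum_list ns) s" "Z \<in> carrier_mat r s"
    and sim: "permutation_similar A (block_form r s (diag_block_mat (map circulant ns)) X Y Z)"
    and ext: "extremal_size n r \<and> all_ones_mat X \<and> all_ones_mat Z \<and> one_nonzero_per_col Y \<or>
      extremal_size n s \<and> all_ones_mat Y \<and> all_ones_mat Z \<and> one_nonzero_per_row X"
    by blast
  then show "real (num_nonzero A) = gamma_bound n"
    using num_nonzero_extremal_block_form[OF assms(2) _ XYZ ext] num_nonzero_permutation_similar[OF sim]
    by simp
qed

end
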